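(* Let a sequence of sparse vectors $\{\mathbf{x}^{(M)}\in\mathbb{C}^M\}_M$ with $\|\mathbf{x}^{(M)}\|_0=L=\lfloor\frac1\beta M\rfloor$, where $\beta>2$, be given. Then asymptotic reliable recovery is possible for $\{\mathbf{x}^{(M)}\}$ with respect to Error Metric 1 if $\frac{L\,\mu^4(\mathbf{x}^{(M)})}{\log L}\to\infty$ as $L\to\infty$ and $N\succ C_1 L$, for some constant $C_1>1$ that depends only on $\beta$, $\mu(\mathbf{x}^{(M)})$ and $\nu$.
   Context: Model: $\mathbf{x}=\mathbf{x}^{(M)}\in\mathbb{C}^M$ is an unknown vector with support $\mathcal{I}=\{i: x_i\ne0\}$, $\|\mathbf{x}\|_0=|\mathcal{I}|=L$, and $\mu(\mathbf{x})=\min_{i\in\mathcal{I}}|x_i|$. One observes $\mathbf{y}=\mathbf{A}\mathbf{x}+\mathbf{n}\in\mathbb{C}^N$, where $N$ is a function of $M$, $\mathbf{A}$ is an $N\times M$ Gaussian measurement matrix (i.i.d. circularly symmetric complex Gaussian entries $a_{i,j}\sim\mathcal{N}_C(0,1)$), and $\mathbf{n}\sim\mathcal{N}_C(0,\nu^2I_N)$ is circularly symmetric complex Gaussian noise independent of $\mathbf{A}$. Decoder: a sparse recovery algorithm, knowing $\mathbf{A}$ and observing $\mathbf{y}$, outputs an estimate $\hat{\mathbf{x}}$ with $\|\hat{\mathbf{x}}\|_0=L$; a decoder $\mathcal{D}$ outputs the corresponding set of indices $\mathcal{D}(\mathbf{y})=\{i:\hat x_i\ne0\}$. Error Metric 1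 ($0$-$1$ loss): recovery is successful iff $\hat x_i\ne0$ for all $i\in\mathcal{I}$ and $\hat x_j=0$ for all $j\notin\mathcal{I}$, i.e. iff $\mathcal{D}(\mathbf{y})=\mathcal{I}$. For fixed $\mathbf{A}$, $p_{\rm err}(\mathbf{A}|\mathbf{x}^{(M)})=\mathbb{P}(\mathcal{D}(\mathbf{y})\ne\mathcal{I})$, and $p_{\rm err}(\mathcal{D}|\mathbf{x}^{(M)})=\mathbb{E}_{\mathbf{A}}\big(p_{\rm err}(\mathbf{A}|\mathbf{x}^{(M)})\big)$ is its average over Gaussian measurement matrices. A decoder achieves asymptotic reliable recovery if $p_{\rm err}(\mathcal{D}|\mathbf{x}^{(M)})\to0$ as $M\to\infty$; recovery is possible if some decoder achieves this. Notation: $f\succ g$ means that either $f=g=0$, or $f,g$ are non-decreasing non-negative functions and there is $x_0$ such that $f(x)/g(x)>1$ for all $x>x_0$ (here as functions of $M$). *)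

theory Defs
  imports "HOL-Probability.Probability"
begin

text \<open>Vectors in \<open>\<complex>\<^sup>M\<close> are functions \<open>nat \<Rightarrow> complex\<close> read at the indices \<open>i < M\<close>;
  \<open>N \<times> M\<close> matrices are functions on \<open>{..<N} \<times> {..<M}\<close>.\<close>

definition vsupp :: "nat \<Rightarrow> (nat \<Rightarrow> complex) \<Rightarrow> nat set" where
  "vsupp M v = {i. i < M \<and> v i \<noteq> 0}"

definition l0norm :: "nat \<Rightarrow> (nat \<Rightarrow> complex) \<Rightarrow> nat" where
  "l0norm M v = card (vsupp M v)"

text \<open>Unspecified for the zero vector.\<close>

definition min_mag :: "nat \<Rightarrow> (nat \<Rightarrow> complex) \<Rightarrow> real" where
  "min_mag M v = Min ((\<lambda>i. cmod (v i)) ` vsupp M v)"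

text \<open>The circularly symmetric law \<open>N\<^sub>C(0, s\<^sup>2)\<close>, for \<open>s > 0\<close>: total variance
  \<open>s\<^sup>2\<close>, hence independent real and imaginary parts of variance \<open>s\<^sup>2 / 2\<close> each.\<close>

definition complex_normal :: "real \<Rightarrow> complex measure" where
  "complex_normal s =
     distr (density lborel (normal_density 0 (s / sqrt 2)) \<Otimes>\<^sub>M
            density lborel (normal_density 0 (s / sqrt 2)))
           borel (\<lambda>(a, b). Complex a b)"

definition gaussian_matrix :: "nat \<Rightarrow> nat \<Rightarrow> (nat \<times> nat \<Rightarrow> complex) measure" where
  "gaussian_matrix N M = Pi\<^sub>M ({..<N} \<times> {..<M}) (\<lambda>_. complex_normal 1)"

definition gaussian_noise :: "real \<Rightarrow> nat \<Rightarrow> (nat \<Rightarrow> complex) measure" where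
  "gaussian_noise \<nu> N = Pi\<^sub>M {..<N} (\<lambda>_. complex_normal \<nu>)"

definition observation ::
  "nat \<Rightarrow> nat \<Rightarrow> (nat \<times> nat \<Rightarrow> complex) \<Rightarrow> (nat \<Rightarrow> complex) \<Rightarrow> (nat \<Rightarrow> complex) \<Rightarrow> nat \<Rightarrow> complex"
where
  "observation N M A v n = (\<lambda>i\<in>{..<N}. (\<Sum>j<M. A (i, j) * v j) + n i)"

text \<open>A decoder maps \<open>(A, y)\<close> to an estimate with exactly \<open>L\<close> nonzero entries.
  Measurability cannot be dropped: \<open>measure\<close> is \<open>0\<close> on non-measurable sets, so the
  error probability of a non-measurable decoder would be meaningless.\<close>

definition sparse_decoder ::
  "nat \<Rightarrow> nat \<Rightarrow> nat \<Rightarrow> ((nat \<times> nat \<Rightarrow> complex) \<Rightarrow> (nat \<Rightarrow> complex) \<Rightarrow> nat \<Rightarrow> complex) \<Rightarrow> bool"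
where
  "sparse_decoder N M L D \<longleftrightarrow>
     (\<lambda>(A, y). D A y) \<in>
       Pi\<^sub>M ({..<N} \<times> {..<M}) (\<lambda>_. borel) \<Otimes>\<^sub>M Pi\<^sub>M {..<N} (\<lambda>_. borel)
         \<rightarrow>\<^sub>M Pi\<^sub>M {..<M} (\<lambda>_. borel) \<and>
     (\<forall>A \<in> ({..<N} \<times> {..<M}) \<rightarrow>\<^sub>E UNIV. \<forall>y \<in> {..<N} \<rightarrow>\<^sub>E UNIV. l0norm M (D A y) = L)"

text \<open>Error probability under the 0-1 loss: for a fixed matrix, and averaged over
  Gaussian matrices.\<close>

definition p_err_fixed ::
  "real \<Rightarrow> nat \<Rightarrow> nat \<Rightarrow> ((nat \<times> nat \<Rightarrow> complex) \<Rightarrow> (nat \<Rightarrow> complex) \<Rightarrow> nat \<Rightarrow> complex) \<Rightarrow>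
   (nat \<Rightarrow> complex) \<Rightarrow> (nat \<times> nat \<Rightarrow> complex) \<Rightarrow> real"
where
  "p_err_fixed \<nu> N M D v A =
     measure (gaussian_noise \<nu> N)
       {n \<in> space (gaussian_noise \<nu> N). vsupp M (D A (observation N M A v n)) \<noteq> vsupp M v}"

definition p_err ::
  "real \<Rightarrow> nat \<Rightarrow> nat \<Rightarrow> ((nat \<times> nat \<Rightarrow> complex) \<Rightarrow> (nat \<Rightarrow> complex) \<Rightarrow> nat \<Rightarrow> complex) \<Rightarrow>
   (nat \<Rightarrow> complex) \<Rightarrow> real"
where
  "p_err \<nu> N M D v = (LINT A|gaussian_matrix N M. p_err_fixed \<nu> N M D v A)"

definition reliable_recovery ::
  "real \<Rightarrow> (nat \<Rightarrow> nat) \<Rightarrow>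
   (nat \<Rightarrow> (nat \<times> nat \<Rightarrow> complex) \<Rightarrow> (nat \<Rightarrow> complex) \<Rightarrow> nat \<Rightarrow> complex) \<Rightarrow>
   (nat \<Rightarrow> nat \<Rightarrow> complex) \<Rightarrow> bool"
where
  "reliable_recovery \<nu> N D x \<longleftrightarrow> (\<lambda>M. p_err \<nu> (N M) M (D M) (x M)) \<longlonglongrightarrow> 0"

definition eventually_dominates :: "(nat \<Rightarrow> real) \<Rightarrow> (nat \<Rightarrow> real) \<Rightarrow> bool"  (infix "\<succ>" 50) where
  "f \<succ> g \<longleftrightarrow>
     (\<forall>n. f n = 0 \<and> g n = 0) \<or>
     (mono f \<and> mono g \<and> (\<forall>n. 0 \<le> f n \<and> 0 \<le> g n) \<and> (\<exists>n0. \<forall>n>n0. f n / g n > 1))"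

definition sparsity :: "real \<Rightarrow> nat \<Rightarrow> nat" where
  "sparsity \<beta> M = nat \<lfloor>(1 / \<beta>) * real M\<rfloor>"

end

theory Submission
  imports Defs "HOL-Real_Asymp.Real_Asymp"
begin

text \<open>The decoder picks the \<open>L\<close>-subset \<open>J\<close> of columns with the least residual
  \<open>min\<^sub>z \<parallel>y - A\<^sub>J z\<parallel>\<^sup>2\<close>. Put \<open>m = N - L\<close> and \<open>a = min(1, \<mu>\<^sup>2/\<nu>\<^sup>2)\<close>. The residual
  of the true support is \<open>\<nu>\<^sup>2\<close> times a chi-square variable with \<open>m\<close> complex degrees of freedom (a
  Gaussian matrix has independent columns almost surely), and exceeds \<open>T = m\<nu>\<^sup>2(1 + a/2)\<close> with
  probability at most \<open>exp(-ma\<^sup>2/32)\<close>. For a support missing \<open>k\<close> indices the residual dominates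
  such a variable with variance at least \<open>\<nu>\<^sup>2(1 + ka)\<close>, and falls below \<open>T\<close> with probability at
  most \<open>exp(-m min(1, ka)\<^sup>2/64)\<close>. In the union bound the supports with \<open>ka \<ge> 1\<close> contribute at
  most \<open>2\<^sup>M exp(-m/64)\<close>, small because \<open>m \<ge> 64M\<close>; the others are indexed by their symmetric
  difference with the true support, of size \<open>2k\<close>, and contribute at most \<open>(1 + r)\<^sup>M - 1\<close> with
  \<open>r = exp(-ma\<^sup>2/128)\<close>, small because \<open>ma\<^sup>2\<close> is large compared to \<open>log M\<close>.

  Rotation invariance is never used. For orthonormal \<open>u\<^sub>k\<close> in the complement of the columns, the
  moments \<open>E exp(\<plusminus>s \<Sum>|\<langle>u\<^sub>k, g\<rangle>|\<^sup>2)\<close> are linearised with an auxiliary Gaussian vector \<open>h\<close>, using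
  \<open>exp(-s|w|\<^sup>2) = E\<^sub>h exp(2i\<surd>s Re(wh))\<close>, respectively \<open>exp(s|w|\<^sup>2) = E\<^sub>h exp(2\<surd>s Re(wh))\<close>, so
  that only one-dimensional Gaussian integrals remain.\<close>

section \<open>Gaussian vectors\<close>

abbreviation gauss1 :: "real \<Rightarrow> real measure" where
  "gauss1 s \<equiv> density lborel (normal_density 0 (s / sqrt 2))"

lemma prob_space_gauss1: "s > 0 \<Longrightarrow> prob_space (gauss1 s)"
  by (rule prob_space_normal_density) simp

lemma measurable_cis[measurable]: "cis \<in> borel_measurable borel"
  by (intro borel_measurable_continuous_onI continuous_intros)

text \<open>Scaling by \<open>r = s / sqrt 2\<close> reduces this to the characteristic function of
  the standard normal distribution.\<close>

lemma gauss1_char: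
  assumes "s > 0"
  shows "(LINT x|gauss1 s. cis (t * x)) = of_real (exp (- (s * t)\<^sup>2 / 4))"
proof -
  define r where "r = s / sqrt 2"
  have r: "r > 0" using assms by (simp add: r_def)
  have d: "normal_density 0 r (r * x) * r = std_normal_density x" for x
    using r by (simp add: normal_density_def power_mult_distrib real_sqrt_mult)
  have "(LINT x|gauss1 s. cis (t * x)) = (LINT x|lborel. normal_density 0 r x *\<^sub>R cis (t * x))"
    unfolding r_def by (subst integral_density) auto
  also have "\<dots> = \<bar>r\<bar> *\<^sub>R (LINT x|lborel. normal_density 0 r (0 + r * x) *\<^sub>R cis (t * (0 + r * x)))"
    using r by (intro lborel_integral_real_affine) auto
  also have "\<dots> = (LINT x|lborel. std_normal_density x *\<^sub>R cis ((t * r) * x))"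
    using r by (subst integral_scaleR_right[symmetric])
      (simp add: d[symmetric] mult_ac del: integral_scaleR_right)
  also have "\<dots> = char std_normal_distribution (t * r)"
    unfolding char_def by (subst integral_density) (auto simp: cis_conv_exp)
  also have "\<dots> = of_real (exp (- (s * t)\<^sup>2 / 4))"
    unfolding char_std_normal_distribution r_def by (simp add: power_mult_distrib power_divide mult_ac)
  finally show ?thesis .
qed

lemma nn_integral_normal_density: "s > 0 \<Longrightarrow> (\<integral>\<^sup>+x. ennreal (normal_density m s x) \<partial>lborel) = 1"
  by (subst nn_integral_eq_integral) auto

text \<open>Completing the square turns the integrand into a constant times the normal density with
  mean \<open>r\<^sup>2 * t\<close>. The nonnegative integral is used so that Tonelli applies later
  without a proof of integrability.\<close>

lemma gauss1_mgf:
  assumes "s > 0"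
  shows "(\<integral>\<^sup>+x. ennreal (exp (t * x)) \<partial>gauss1 s) = ennreal (exp ((s * t)\<^sup>2 / 4))"
proof -
  define r where "r = s / sqrt 2"
  have r: "r > 0" using assms by (simp add: r_def)
  have e: "normal_density 0 r x * exp (t * x) =
      exp ((s * t)\<^sup>2 / 4) * normal_density (r\<^sup>2 * t) r x" for x
  proof -
    have "- x\<^sup>2 / (2 * r\<^sup>2) + t * x = (s * t)\<^sup>2 / 4 - (x - r\<^sup>2 * t)\<^sup>2 / (2 * r\<^sup>2)"
    proof -
      have "s\<^sup>2 = 2 * r\<^sup>2" by (simp add: r_def power_divide)
      then show ?thesis using r by (simp add: power_mult_distrib) (simp add: power2_eq_square field_simps)
    qed
    then have "exp (- x\<^sup>2 / (2 * r\<^sup>2)) * exp (t * x)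
        = exp ((s * t)\<^sup>2 / 4) * exp (- (x - r\<^sup>2 * t)\<^sup>2 / (2 * r\<^sup>2))"
      by (simp flip: exp_add)
    then show ?thesis unfolding normal_density_def by simp
  qed
  have "(\<integral>\<^sup>+x. ennreal (exp (t * x)) \<partial>gauss1 s)
      = (\<integral>\<^sup>+x. ennreal (normal_density 0 r x * exp (t * x)) \<partial>lborel)"
    unfolding r_def by (subst nn_integral_density) (auto simp: ennreal_mult)
  also have "\<dots> = (\<integral>\<^sup>+x. ennreal (exp ((s * t)\<^sup>2 / 4)) * ennreal (normal_density (r\<^sup>2 * t) r x) \<partial>lborel)"
    unfolding e by (simp add: ennreal_mult)
  also have "\<dots> = ennreal (exp ((s * t)\<^sup>2 / 4))"
    using r by (subst nn_integral_cmult) (auto simp: nn_integral_normal_density)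
  finally show ?thesis .
qed

lemma gauss1_square:
  assumes "c > -1"
  shows "(\<integral>\<^sup>+x. ennreal (exp (- c * x\<^sup>2)) \<partial>gauss1 1) = ennreal (1 / sqrt (1 + c))"
proof -
  define r where "r = 1 / sqrt (2 * (1 + c))"
  have r: "r > 0" "r\<^sup>2 = 1 / (2 * (1 + c))" using assms by (auto simp: r_def power_divide)
  have e: "normal_density 0 (1 / sqrt 2) x * exp (- c * x\<^sup>2) = 1 / sqrt (1 + c) * normal_density 0 r x" for x
  proof -
    have "exp (- x\<^sup>2 / (2 * (1 / sqrt 2)\<^sup>2)) * exp (- c * x\<^sup>2) = exp (- x\<^sup>2 / (2 * r\<^sup>2))"
      unfolding r using assms by (simp add: power_divide algebra_simps flip: exp_add)
    moreover have "1 / sqrt (2 * pi * (1 / sqrt 2)\<^sup>2) = 1 / sqrt (1 + c) * (1 / sqrt (2 * pi * r\<^sup>2))"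
      unfolding r using assms by (simp add: power_divide flip: real_sqrt_mult real_sqrt_divide) (simp add: field_simps)
    ultimately show ?thesis unfolding normal_density_def by simp
  qed
  have "(\<integral>\<^sup>+x. ennreal (exp (- c * x\<^sup>2)) \<partial>gauss1 1)
      = (\<integral>\<^sup>+x. ennreal (normal_density 0 (1 / sqrt 2) x * exp (- c * x\<^sup>2)) \<partial>lborel)"
    by (subst nn_integral_density) (auto simp: ennreal_mult)
  also have "\<dots> = (\<integral>\<^sup>+x. ennreal (1 / sqrt (1 + c)) * ennreal (normal_density 0 r x) \<partial>lborel)"
    unfolding e using assms by (intro nn_integral_cong ennreal_mult) auto
  also have "\<dots> = ennreal (1 / sqrt (1 + c))"
    using r by (subst nn_integral_cmult) (auto simp: nn_integral_normal_density)
  finally show ?thesis .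
qed

section \<open>The circularly symmetric complex normal law\<close>

lemma measurable_Complex[measurable]:
  "(\<lambda>(a, b). Complex a b) \<in> borel_measurable (gauss1 s \<Otimes>\<^sub>M gauss1 s)"
proof -
  have "(\<lambda>(a, b). Complex a b) = (\<lambda>p. of_real (fst p) + \<i> * of_real (snd p))"
    by (auto simp: complex_eq_iff)
  then show ?thesis by simp
qed

lemma sets_complex_normal[simp, measurable_cong]: "sets (complex_normal s) = sets borel"
  and space_complex_normal[simp]: "space (complex_normal s) = UNIV"
  unfolding complex_normal_def by auto

lemma prob_space_complex_normal:
  assumes "s > 0" shows "prob_space (complex_normal s)"
proof -
  interpret prob_space "gauss1 s" by (rule prob_space_gauss1) fact
  interpret P: pair_prob_space "gauss1 s" "gauss1 s" ..
  show ?thesis unfolding complex_normal_def by (rule P.prob_space_distr) simp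
qed

lemma complex_normal_nn_prod:
  assumes "s > 0" and [measurable]: "f \<in> borel_measurable borel" "g \<in> borel_measurable borel"
  shows "(\<integral>\<^sup>+h. f (Re h) * g (Im h) \<partial>complex_normal s)
     = (\<integral>\<^sup>+x. f x \<partial>gauss1 s) * (\<integral>\<^sup>+x. g x \<partial>gauss1 s)"
proof -
  interpret prob_space "gauss1 s" by (rule prob_space_gauss1) fact
  have "(\<integral>\<^sup>+h. f (Re h) * g (Im h) \<partial>complex_normal s)
     = (\<integral>\<^sup>+p. f (fst p) * g (snd p) \<partial>(gauss1 s \<Otimes>\<^sub>M gauss1 s))"
    unfolding complex_normal_def by (subst nn_integral_distr) (auto simp: case_prod_beta)
  also have "\<dots> = (\<integral>\<^sup>+x. f x * (\<integral>\<^sup>+y. g y \<partial>gauss1 s) \<partial>gauss1 s)"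
    by (subst nn_integral_fst[symmetric]) (auto simp: nn_integral_cmult)
  also have "\<dots> = (\<integral>\<^sup>+x. f x \<partial>gauss1 s) * (\<integral>\<^sup>+x. g x \<partial>gauss1 s)"
    by (subst nn_integral_multc) auto
  finally show ?thesis .
qed

text \<open>Since \<open>Re (a * h) = Re a * Re h - Im a * Im h\<close>, the integrand is a product
  over the two independent coordinates. That only the modulus of \<open>a\<close> survives is the
  circular symmetry.\<close>

lemma complex_normal_char:
  assumes "s > 0"
  shows "(LINT h|complex_normal s. cis (Re (a * h))) = of_real (exp (- s\<^sup>2 / 4 * (cmod a)\<^sup>2))"
proof -
  interpret prob_space "gauss1 s" by (rule prob_space_gauss1) fact
  interpret P: pair_prob_space "gauss1 s" "gauss1 s" ..
  let ?f = "\<lambda>p. cis (Re a * fst p) * cis (- Im a * snd p)"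
  have "(LINT h|complex_normal s. cis (Re (a * h))) = (LINT p|(gauss1 s \<Otimes>\<^sub>M gauss1 s). ?f p)"
    unfolding complex_normal_def by (subst integral_distr) (auto simp: case_prod_beta cis_mult)
  also have "\<dots> = (LINT x|gauss1 s. LINT y|gauss1 s. ?f (x, y))"
    by (intro P.integral_fst'[symmetric] P.integrable_const_bound[where B=1])
       (auto simp: norm_mult)
  also have "\<dots> = (LINT x|gauss1 s. cis (Re a * x)) * (LINT y|gauss1 s. cis (- Im a * y))"
    by simp
  also have "\<dots> = of_real (exp (- s\<^sup>2 / 4 * (cmod a)\<^sup>2))"
    unfolding gauss1_char[OF assms]
    by (simp add: cmod_power2 power_mult_distrib field_simps flip: of_real_mult exp_add)
  finally show ?thesis .
qed

lemma complex_normal_mgf: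
  assumes "s > 0"
  shows "(\<integral>\<^sup>+h. ennreal (exp (Re (a * h))) \<partial>complex_normal s) = ennreal (exp (s\<^sup>2 / 4 * (cmod a)\<^sup>2))"
proof -
  have "(\<integral>\<^sup>+h. ennreal (exp (Re (a * h))) \<partial>complex_normal s)
    = (\<integral>\<^sup>+h. ennreal (exp (Re a * Re h)) * ennreal (exp (- Im a * Im h)) \<partial>complex_normal s)"
    by (intro nn_integral_cong) (auto simp flip: ennreal_mult exp_add)
  also have "\<dots> = (\<integral>\<^sup>+x. ennreal (exp (Re a * x)) \<partial>gauss1 s) * (\<integral>\<^sup>+x. ennreal (exp (- Im a * x)) \<partial>gauss1 s)"
    using assms by (intro complex_normal_nn_prod) auto
  also have "\<dots> = ennreal (exp (s\<^sup>2 / 4 * (cmod a)\<^sup>2))"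
    unfolding gauss1_mgf[OF assms]
    by (simp add: cmod_power2 power_mult_distrib field_simps flip: ennreal_mult exp_add)
  finally show ?thesis .
qed

lemma complex_normal_square:
  assumes "c > -1"
  shows "(\<integral>\<^sup>+h. ennreal (exp (- c * (cmod h)\<^sup>2)) \<partial>complex_normal 1) = ennreal (1 / (1 + c))"
proof -
  have "(\<integral>\<^sup>+h. ennreal (exp (- c * (cmod h)\<^sup>2)) \<partial>complex_normal 1)
    = (\<integral>\<^sup>+h. ennreal (exp (- c * (Re h)\<^sup>2)) * ennreal (exp (- c * (Im h)\<^sup>2)) \<partial>complex_normal 1)"
    by (intro nn_integral_cong) (auto simp: cmod_power2 algebra_simps simp flip: ennreal_mult exp_add)
  also have "\<dots> = (\<integral>\<^sup>+x. ennreal (exp (- c * x\<^sup>2)) \<partial>gauss1 1) * (\<integral>\<^sup>+x. ennreal (exp (- c * x\<^sup>2)) \<partial>gauss1 1)"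
    by (intro complex_normal_nn_prod) auto
  also have "\<dots> = ennreal (1 / (1 + c))"
    unfolding gauss1_square[OF assms] using assms by (simp flip: ennreal_mult)
  finally show ?thesis .
qed

section \<open>Families of independent complex Gaussians\<close>

abbreviation gauss_vec :: "real \<Rightarrow> 'k set \<Rightarrow> ('k \<Rightarrow> complex) measure" where
  "gauss_vec s K \<equiv> PiM K (\<lambda>_. complex_normal s)"

lemma prob_space_gauss_vec: "s > 0 \<Longrightarrow> prob_space (gauss_vec s K)"
  by (intro prob_space_PiM prob_space_complex_normal)

lemma product_sigma_finite_complex_normal:
  "s > 0 \<Longrightarrow> product_sigma_finite (\<lambda>_. complex_normal s)"
  by (simp add: product_sigma_finite_def prob_space_complex_normal prob_space_imp_sigma_finite)

lemma cis_sum: "cis (sum f K) = (\<Prod>k\<in>K. cis (f k))"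
  by (induction K rule: infinite_finite_induct) (auto simp flip: cis_mult)

lemma gauss_vec_char:
  assumes "s > 0" "finite K"
  shows "(LINT w|gauss_vec s K. cis (Re (\<Sum>k\<in>K. a k * w k)))
     = of_real (exp (- s\<^sup>2 / 4 * (\<Sum>k\<in>K. (cmod (a k))\<^sup>2)))"
proof -
  interpret product_sigma_finite "\<lambda>_::'a. complex_normal s"
    using assms by (simp add: product_sigma_finite_complex_normal)
  interpret prob_space "complex_normal s" using assms by (simp add: prob_space_complex_normal)
  have "(LINT w|gauss_vec s K. cis (Re (\<Sum>k\<in>K. a k * w k)))
      = (LINT w|gauss_vec s K. (\<Prod>k\<in>K. cis (Re (a k * w k))))"
    by (simp only: Re_sum cis_sum)
  also have "\<dots> = (\<Prod>k\<in>K. (LINT h|complex_normal s. cis (Re (a k * h))))"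
    using assms by (intro product_integral_prod integrable_const_bound[where B=1]) auto
  also have "\<dots> = of_real (exp (- s\<^sup>2 / 4 * (\<Sum>k\<in>K. (cmod (a k))\<^sup>2)))"
    unfolding complex_normal_char[OF assms(1)] using assms
    by (simp add: exp_sum sum_distrib_left flip: of_real_prod)
  finally show ?thesis .
qed

lemma gauss_vec_mgf:
  assumes "s > 0" "finite K"
  shows "(\<integral>\<^sup>+w. ennreal (exp (Re (\<Sum>k\<in>K. a k * w k))) \<partial>gauss_vec s K)
     = ennreal (exp (s\<^sup>2 / 4 * (\<Sum>k\<in>K. (cmod (a k))\<^sup>2)))"
proof -
  interpret product_sigma_finite "\<lambda>_::'a. complex_normal s"
    using assms by (simp add: product_sigma_finite_complex_normal)
  have "(\<integral>\<^sup>+w. ennreal (exp (Re (\<Sum>k\<in>K. a k * w k))) \<partial>gauss_vec s K)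
      = (\<integral>\<^sup>+w. (\<Prod>k\<in>K. ennreal (exp (Re (a k * w k)))) \<partial>gauss_vec s K)"
    using assms by (simp only: Re_sum exp_sum prod_ennreal exp_ge_zero)
  also have "\<dots> = (\<Prod>k\<in>K. (\<integral>\<^sup>+h. ennreal (exp (Re (a k * h))) \<partial>complex_normal s))"
    using assms by (intro product_nn_integral_prod) auto
  also have "\<dots> = ennreal (exp (s\<^sup>2 / 4 * (\<Sum>k\<in>K. (cmod (a k))\<^sup>2)))"
    unfolding complex_normal_mgf[OF assms(1)] using assms
    by (simp add: exp_sum sum_distrib_left prod_ennreal)
  finally show ?thesis .
qed

text \<open>The closed form in which both linearisations below end: with \<open>c = s * v\<close>
  for the Laplace transform and \<open>c = - s * v\<close> for the exponential moment.\<close>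

lemma gauss_vec_square:
  assumes "c > -1" "finite K"
  shows "(\<integral>\<^sup>+w. ennreal (exp (- c * (\<Sum>k\<in>K. (cmod (w k))\<^sup>2))) \<partial>gauss_vec 1 K)
     = ennreal ((1 / (1 + c)) ^ card K)"
proof -
  interpret product_sigma_finite "\<lambda>_::'a. complex_normal 1"
    by (simp add: product_sigma_finite_complex_normal)
  have "(\<integral>\<^sup>+w. ennreal (exp (- c * (\<Sum>k\<in>K. (cmod (w k))\<^sup>2))) \<partial>gauss_vec 1 K)
      = (\<integral>\<^sup>+w. (\<Prod>k\<in>K. ennreal (exp (- c * (cmod (w k))\<^sup>2))) \<partial>gauss_vec 1 K)"
    using assms by (simp only: sum_distrib_left exp_sum prod_ennreal exp_ge_zero)
  also have "\<dots> = (\<Prod>k\<in>K. (\<integral>\<^sup>+h. ennreal (exp (- c * (cmod h)\<^sup>2)) \<partial>complex_normal 1))"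
    using assms by (intro product_nn_integral_prod) auto
  also have "\<dots> = ennreal ((1 / (1 + c)) ^ card K)"
    unfolding complex_normal_square[OF assms(1)] using assms by (simp add: ennreal_power)
  finally show ?thesis .
qed

text \<open>Fubini for a bilinear phase in \<open>W\<close> and an independent Gaussian
  \<open>h\<close>: integrating over \<open>h\<close> first gives the left side, integrating over
  \<open>w\<close> first gives a Gaussian integral in \<open>h\<close>. Thus the characteristic
  function of linear forms suffices, and no joint law of the \<open>W k\<close> has to be
  identified.\<close>

lemma laplace_transform_sum_squares:
  fixes W :: "nat \<Rightarrow> 'w \<Rightarrow> complex"
  assumes "prob_space \<Omega>" and W[measurable]: "\<And>k. k < m \<Longrightarrow> W k \<in> borel_measurable \<Omega>"
    and char: "\<And>p. (LINT w|\<Omega>. cis (Re (\<Sum>k<m. p k * W k w)))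
        = of_real (exp (- v / 4 * (\<Sum>k<m. (cmod (p k))\<^sup>2)))"
    and "s \<ge> 0" "v \<ge> 0"
  shows "(\<integral>\<^sup>+w. ennreal (exp (- s * (\<Sum>k<m. (cmod (W k w))\<^sup>2))) \<partial>\<Omega>) = ennreal ((1 / (1 + s * v)) ^ m)"
proof -
  interpret O: prob_space \<Omega> by fact
  define H where "H = gauss_vec 1 {..<m}"
  interpret H: prob_space H unfolding H_def by (simp add: prob_space_gauss_vec)
  interpret P: pair_prob_space \<Omega> H ..
  have mH[measurable]: "(\<lambda>h. h k) \<in> borel_measurable H" if "k < m" for k
    unfolding H_def using that by simp
  \<comment> \<open>The factor \<open>2 * sqrt s\<close> has square \<open>4 * s\<close>, which
    cancels the 1/4 in the characteristic function.\<close>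
  let ?f = "\<lambda>w h. cis (Re (\<Sum>k<m. complex_of_real (2 * sqrt s) * W k w * h k))"
  have 1: "(LINT h|H. ?f w h) = of_real (exp (- s * (\<Sum>k<m. (cmod (W k w))\<^sup>2)))" for w
    unfolding H_def by (subst gauss_vec_char) (use assms in \<open>auto simp: norm_mult power_mult_distrib sum_distrib_left\<close>)
  have 2: "(LINT w|\<Omega>. ?f w h) = of_real (exp (- (s * v) * (\<Sum>k<m. (cmod (h k))\<^sup>2)))" for h
  proof -
    have "(LINT w|\<Omega>. ?f w h) = (LINT w|\<Omega>. cis (Re (\<Sum>k<m. (of_real (2 * sqrt s) * h k) * W k w)))"
      by (simp add: mult_ac)
    also have "\<dots> = of_real (exp (- v / 4 * (\<Sum>k<m. (cmod (of_real (2 * sqrt s) * h k))\<^sup>2)))"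
      by (rule char)
    also have "\<dots> = of_real (exp (- (s * v) * (\<Sum>k<m. (cmod (h k))\<^sup>2)))"
      using assms by (auto simp: norm_mult power_mult_distrib sum_distrib_left intro!: sum.cong)
    finally show ?thesis .
  qed
  have int: "integrable (\<Omega> \<Otimes>\<^sub>M H) (\<lambda>(w, h). ?f w h)"
    by (intro P.integrable_const_bound[where B=1]) (auto simp: case_prod_beta)
  have "(LINT w|\<Omega>. LINT h|H. ?f w h) = (LINT h|H. LINT w|\<Omega>. ?f w h)"
    by (rule P.Fubini_integral[OF int, symmetric])
  then have "(LINT w|\<Omega>. exp (- s * (\<Sum>k<m. (cmod (W k w))\<^sup>2)))
      = (LINT h|H. exp (- (s * v) * (\<Sum>k<m. (cmod (h k))\<^sup>2)))"
    unfolding 1 2 by simp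
  \<comment> \<open>Fubini for \<open>cis\<close> needs Lebesgue integrals, whereas
    \<open>gauss_vec_square\<close> speaks of nonnegative ones; the two agree since the integrands
    are bounded by 1.\<close>
  moreover have "(\<integral>\<^sup>+w. ennreal (exp (- s * (\<Sum>k<m. (cmod (W k w))\<^sup>2))) \<partial>\<Omega>)
      = ennreal (LINT w|\<Omega>. exp (- s * (\<Sum>k<m. (cmod (W k w))\<^sup>2)))"
    using assms(4) by (intro nn_integral_eq_integral O.integrable_const_bound[where B=1])
      (auto simp: sum_nonneg mult_nonneg_nonneg)
  moreover have "(\<integral>\<^sup>+h. ennreal (exp (- (s * v) * (\<Sum>k<m. (cmod (h k))\<^sup>2))) \<partial>H)
      = ennreal (LINT h|H. exp (- (s * v) * (\<Sum>k<m. (cmod (h k))\<^sup>2)))"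
    using assms(4,5) by (intro nn_integral_eq_integral H.integrable_const_bound[where B=1])
      (auto simp: sum_nonneg mult_nonneg_nonneg)
  moreover have "s * v > -1" using mult_nonneg_nonneg[OF assms(4,5)] by linarith
  ultimately show ?thesis
    unfolding H_def by (subst (asm) gauss_vec_square) auto
qed

text \<open>The same exchange with real exponentials, where nonnegativity makes Tonelli applicable.
  The condition \<open>s * v < 1\<close> is the convergence condition \<open>c > -1\<close> for the
  final Gaussian integral.\<close>

lemma exp_moment_sum_squares:
  fixes W :: "nat \<Rightarrow> 'w \<Rightarrow> complex"
  assumes "prob_space \<Omega>" and W[measurable]: "\<And>k. k < m \<Longrightarrow> W k \<in> borel_measurable \<Omega>"
    and mgf: "\<And>p. (\<integral>\<^sup>+w. ennreal (exp (Re (\<Sum>k<m. p k * W k w))) \<partial>\<Omega>)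
        = ennreal (exp (v / 4 * (\<Sum>k<m. (cmod (p k))\<^sup>2)))"
    and "s \<ge> 0" "s * v < 1"
  shows "(\<integral>\<^sup>+w. ennreal (exp (s * (\<Sum>k<m. (cmod (W k w))\<^sup>2))) \<partial>\<Omega>) = ennreal ((1 / (1 - s * v)) ^ m)"
proof -
  interpret O: prob_space \<Omega> by fact
  define H where "H = gauss_vec 1 {..<m}"
  interpret H: prob_space H unfolding H_def by (simp add: prob_space_gauss_vec)
  interpret P: pair_prob_space \<Omega> H ..
  have mH[measurable]: "(\<lambda>h. h k) \<in> borel_measurable H" if "k < m" for k
    unfolding H_def using that by simp
  let ?f = "\<lambda>w h. ennreal (exp (Re (\<Sum>k<m. complex_of_real (2 * sqrt s) * W k w * h k)))"
  have 1: "(\<integral>\<^sup>+h. ?f w h \<partial>H) = ennreal (exp (s * (\<Sum>k<m. (cmod (W k w))\<^sup>2)))" for w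
    unfolding H_def by (subst gauss_vec_mgf) (use assms in \<open>auto simp: norm_mult power_mult_distrib sum_distrib_left\<close>)
  have 2: "(\<integral>\<^sup>+w. ?f w h \<partial>\<Omega>) = ennreal (exp (- (- s * v) * (\<Sum>k<m. (cmod (h k))\<^sup>2)))" for h
  proof -
    have "(\<integral>\<^sup>+w. ?f w h \<partial>\<Omega>) = (\<integral>\<^sup>+w. ennreal (exp (Re (\<Sum>k<m. (of_real (2 * sqrt s) * h k) * W k w))) \<partial>\<Omega>)"
      by (simp add: mult_ac)
    also have "\<dots> = ennreal (exp (v / 4 * (\<Sum>k<m. (cmod (of_real (2 * sqrt s) * h k))\<^sup>2)))"
      by (rule mgf)
    also have "\<dots> = ennreal (exp (- (- s * v) * (\<Sum>k<m. (cmod (h k))\<^sup>2)))"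
      using assms by (auto simp: norm_mult power_mult_distrib sum_distrib_left intro!: sum.cong arg_cong[of _ _ ennreal])
    finally show ?thesis .
  qed
  have "(\<integral>\<^sup>+w. \<integral>\<^sup>+h. ?f w h \<partial>H \<partial>\<Omega>) = (\<integral>\<^sup>+h. \<integral>\<^sup>+w. ?f w h \<partial>\<Omega> \<partial>H)"
    by (rule P.Fubini'[symmetric]) simp
  then show ?thesis
    unfolding 1 2 unfolding H_def by (subst (asm) gauss_vec_square) (use assms in auto)
qed

section \<open>Orthonormal complements\<close>

text \<open>Gaussian elimination, by induction on the equations: a nonzero equation is solved for a
  pivot unknown, which leaves one equation and one unknown fewer. Arbitrary index types allow
  equations and unknowns to be tagged unions later.\<close>

lemma underdetermined_solution:
  fixes c :: "'e \<Rightarrow> 'v \<Rightarrow> complex"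
  assumes "finite E" "finite S" "card E < card S"
  shows "\<exists>v. (\<exists>i\<in>S. v i \<noteq> 0) \<and> (\<forall>e\<in>E. (\<Sum>i\<in>S. c e i * v i) = 0)"
  using assms
proof (induction E arbitrary: S c rule: finite_induct)
  case empty
  then obtain i where "i \<in> S" by fastforce
  then show ?case by (intro exI[of _ "\<lambda>_. 1"]) auto
next
  case (insert e E)
  show ?case
  proof (cases "\<forall>i\<in>S. c e i = 0")
    case True
    obtain v where "\<exists>i\<in>S. v i \<noteq> 0" "\<forall>e\<in>E. (\<Sum>i\<in>S. c e i * v i) = 0"
      using insert.IH[of S c] insert.prems insert.hyps by auto
    then show ?thesis using True by (intro exI[of _ v]) auto
  next
    case False
    then obtain p where p: "p \<in> S" "c e p \<noteq> 0" by auto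
    \<comment> \<open>Row \<open>f\<close> after subtracting the multiple of row \<open>e\<close>
      that cancels its entry at the pivot \<open>p\<close>.\<close>
    let ?c = "\<lambda>f i. c f i - c f p * c e i / c e p"
    have "card E < card (S - {p})"
      using insert.prems insert.hyps p by simp
    then obtain v where v: "\<exists>i\<in>S - {p}. v i \<noteq> 0" "\<forall>f\<in>E. (\<Sum>i\<in>S - {p}. ?c f i * v i) = 0"
      using insert.IH[of "S - {p}" ?c] insert.prems by auto
    \<comment> \<open>The value of the pivot unknown forced by equation \<open>e\<close>.\<close>
    define x where "x = - (\<Sum>i\<in>S - {p}. c e i * v i) / c e p"
    have split: "(\<Sum>i\<in>S. c f i * (v(p := x)) i) = c f p * x + (\<Sum>i\<in>S - {p}. c f i * v i)" for f
      using p insert.prems by (subst sum.remove[of S p]) (auto intro!: sum.cong)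
    have "(\<Sum>i\<in>S. c f i * (v(p := x)) i) = 0" if "f \<in> insert e E" for f
    proof (cases "f = e")
      case True
      then show ?thesis unfolding split using p by (simp add: x_def)
    next
      case False
      then have "(\<Sum>i\<in>S - {p}. ?c f i * v i) = 0" using v that by auto
      moreover have "(\<Sum>i\<in>S - {p}. ?c f i * v i) = c f p * x + (\<Sum>i\<in>S - {p}. c f i * v i)"
        using p by (simp add: x_def algebra_simps sum_subtractf sum_distrib_left sum_divide_distrib)
      ultimately show ?thesis unfolding split by (simp only:)
    qed
    moreover have "\<exists>i\<in>S. (v(p := x)) i \<noteq> 0" using v by auto
    ultimately show ?thesis by blast
  qed
qed

section \<open>Hermitian geometry on the first \<open>N\<close> coordinates\<close>

definition inner_n :: "nat \<Rightarrow> (nat \<Rightarrow> complex) \<Rightarrow> (nat \<Rightarrow> complex) \<Rightarrow> complex" where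
  "inner_n N u v = (\<Sum>i<N. cnj (u i) * v i)"

definition sqnorm_n :: "nat \<Rightarrow> (nat \<Rightarrow> complex) \<Rightarrow> real" where
  "sqnorm_n N v = (\<Sum>i<N. (cmod (v i))\<^sup>2)"

lemma inner_n_self: "inner_n N v v = of_real (sqnorm_n N v)"
  unfolding inner_n_def sqnorm_n_def of_real_sum
  by (intro sum.cong refl) (metis complex_norm_square mult.commute)

lemma sqnorm_n_nonneg: "0 \<le> sqnorm_n N v"
  unfolding sqnorm_n_def by (simp add: sum_nonneg)

lemma sqnorm_n_eq_0: "sqnorm_n N v = 0 \<longleftrightarrow> (\<forall>i<N. v i = 0)"
  unfolding sqnorm_n_def by (subst sum_nonneg_eq_0_iff) auto

lemma inner_n_add: "inner_n N u (\<lambda>i. v i + w i) = inner_n N u v + inner_n N u w"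
  and inner_n_add_left: "inner_n N (\<lambda>i. v i + w i) u = inner_n N v u + inner_n N w u"
  and inner_n_cmult: "inner_n N u (\<lambda>i. a * v i) = a * inner_n N u v"
  and inner_n_cnj: "cnj (inner_n N u v) = inner_n N v u"
  unfolding inner_n_def by (auto simp: algebra_simps sum.distrib sum_distrib_left)

lemma inner_n_sum: "inner_n N u (\<lambda>i. \<Sum>k\<in>K. a k * v k i) = (\<Sum>k\<in>K. a k * inner_n N u (v k))"
  unfolding inner_n_def by (simp add: sum_distrib_left mult_ac) (rule sum.swap)

lemma inner_n_sum_left:
  "inner_n N (\<lambda>i. \<Sum>k\<in>K. a k * v k i) u = (\<Sum>k\<in>K. cnj (a k) * inner_n N (v k) u)"
  by (subst inner_n_cnj[symmetric]) (simp add: inner_n_sum inner_n_cnj)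

lemma sqnorm_n_add_orthogonal:
  assumes "inner_n N u v = 0"
  shows "sqnorm_n N (\<lambda>i. u i + v i) = sqnorm_n N u + sqnorm_n N v"
proof -
  have "inner_n N v u = 0" using assms inner_n_cnj[of N u v] by simp
  then have "complex_of_real (sqnorm_n N (\<lambda>i. u i + v i)) = of_real (sqnorm_n N u + sqnorm_n N v)"
    using assms by (simp add: inner_n_self[symmetric] inner_n_add inner_n_add_left)
  then show ?thesis by (simp only: of_real_eq_iff)
qed

lemma sqnorm_n_cmult: "sqnorm_n N (\<lambda>i. a * v i) = (cmod a)\<^sup>2 * sqnorm_n N v"
  unfolding sqnorm_n_def by (simp add: norm_mult power_mult_distrib sum_distrib_left)

definition orthonormal_n :: "nat \<Rightarrow> nat \<Rightarrow> (nat \<Rightarrow> nat \<Rightarrow> complex) \<Rightarrow> bool" where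
  "orthonormal_n N m u \<longleftrightarrow> (\<forall>k<m. \<forall>l<m. inner_n N (u k) (u l) = (if k = l then 1 else 0))"

text \<open>One vector is added at a time: orthogonality to the vectors already found and to the
  \<open>b j\<close> amounts to at most \<open>m + card J < N\<close> equations in \<open>N\<close>
  unknowns, and a nonzero solution is normalised. The \<open>b j\<close> may be dependent.\<close>

lemma orthonormal_complement:
  fixes b :: "'j \<Rightarrow> nat \<Rightarrow> complex"
  assumes "finite J" "card J + m \<le> N"
  shows "\<exists>u. orthonormal_n N m u \<and> (\<forall>k<m. \<forall>j\<in>J. inner_n N (u k) (b j) = 0)"
  using assms
proof (induction m)
  case 0
  show ?case by (auto simp: orthonormal_n_def)
next
  case (Suc m)
  then obtain u where u: "orthonormal_n N m u" "\<forall>k<m. \<forall>j\<in>J. inner_n N (u k) (b j) = 0" by auto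
  \<comment> \<open>\<open>Inl\<close> tags the vectors already constructed, \<open>Inr\<close> the
    given ones.\<close>
  let ?E = "Inl ` {..<m} \<union> Inr ` J :: (nat + 'j) set"
  let ?c = "\<lambda>e i. cnj (case e of Inl k \<Rightarrow> u k i | Inr j \<Rightarrow> b j i)"
  have "card ?E \<le> m + card J"
    using card_Un_le[of "Inl ` {..<m} :: (nat + 'j) set" "Inr ` J"]
    by (simp add: card_image)
  then have "card ?E < card {..<N}" using Suc.prems by simp
  then obtain v where v: "\<exists>i\<in>{..<N}. v i \<noteq> 0" "\<forall>e\<in>?E. (\<Sum>i\<in>{..<N}. ?c e i * v i) = 0"
    using underdetermined_solution[of ?E "{..<N}" ?c] Suc.prems by auto
  define w where "w = (\<lambda>i. of_real (1 / sqrt (sqnorm_n N v)) * v i)"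
  have pos: "sqnorm_n N v > 0"
    using v(1) sqnorm_n_nonneg[of N v] sqnorm_n_eq_0[of N v] by (force simp: less_le)
  have "sqnorm_n N w = 1 / sqnorm_n N v * sqnorm_n N v"
    using pos unfolding w_def sqnorm_n_cmult by (simp add: norm_divide power_divide)
  then have ww: "inner_n N w w = 1" using pos by (simp add: inner_n_self)
  have uv: "inner_n N (u k) v = 0" if "k < m" for k
    using v(2) that unfolding inner_n_def by (auto dest: bspec[of _ _ "Inl k"])
  have bv: "inner_n N (b j) v = 0" if "j \<in> J" for j
    using v(2) that unfolding inner_n_def by (auto dest: bspec[of _ _ "Inr j"])
  have uw: "inner_n N (u k) w = 0" "inner_n N w (u k) = 0" if "k < m" for k
    using uv[OF that] inner_n_cnj[of N "u k" w] unfolding w_def inner_n_cmult by auto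
  have bw: "inner_n N w (b j) = 0" if "j \<in> J" for j
    using bv[OF that] inner_n_cnj[of N "b j" w] unfolding w_def inner_n_cmult by auto
  have "orthonormal_n N (Suc m) (u(m := w)) \<and> (\<forall>k<Suc m. \<forall>j\<in>J. inner_n N ((u(m := w)) k) (b j) = 0)"
    using u ww uw bw unfolding orthonormal_n_def by (auto simp: less_Suc_eq)
  then show ?case by blast
qed

lemma sqnorm_n_orthonormal_combination:
  assumes "orthonormal_n N m u"
  shows "sqnorm_n N (\<lambda>i. \<Sum>k<m. p k * u k i) = (\<Sum>k<m. (cmod (p k))\<^sup>2)"
proof -
  have "complex_of_real (sqnorm_n N (\<lambda>i. \<Sum>k<m. p k * u k i))
      = (\<Sum>k<m. cnj (p k) * (\<Sum>l<m. p l * inner_n N (u k) (u l)))"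
    by (simp only: inner_n_self[symmetric] inner_n_sum_left) (simp only: inner_n_sum)
  also have "\<dots> = (\<Sum>k<m. cnj (p k) * (\<Sum>l<m. if l = k then p k else 0))"
    using assms unfolding orthonormal_n_def by (intro sum.cong refl arg_cong2[of _ _ _ _ "(*)"]) auto
  also have "\<dots> = (\<Sum>k<m. complex_of_real ((cmod (p k))\<^sup>2))"
    by (intro sum.cong refl) (simp add: complex_norm_square mult.commute del: of_real_power)
  finally show ?thesis by (simp only: of_real_eq_iff flip: of_real_sum)
qed

lemma inner_n_orthonormal_combination:
  assumes "orthonormal_n N m u" "k < m"
  shows "inner_n N (u k) (\<lambda>i. \<Sum>l<m. p l * u l i) = p k"
proof -
  have "inner_n N (u k) (\<lambda>i. \<Sum>l<m. p l * u l i) = (\<Sum>l<m. if l = k then p k else 0)"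
    unfolding inner_n_sum using assms unfolding orthonormal_n_def by (intro sum.cong refl) auto
  then show ?thesis using assms by simp
qed

text \<open>The vector splits orthogonally into its projection \<open>q\<close> and the remainder
  \<open>r\<close>. This is what bounds the residual of a wrong support from below.\<close>

lemma bessel_inequality:
  assumes "orthonormal_n N m u"
  shows "(\<Sum>k<m. (cmod (inner_n N (u k) v))\<^sup>2) \<le> sqnorm_n N v"
proof -
  define q where "q = (\<lambda>i. \<Sum>k<m. inner_n N (u k) v * u k i)"
  define r where "r = (\<lambda>i. v i + (-1) * q i)"
  have ur: "inner_n N (u k) r = 0" if "k < m" for k
    unfolding r_def inner_n_add inner_n_cmult q_def inner_n_orthonormal_combination[OF assms that] by simp
  have "inner_n N q r = 0"
    unfolding q_def inner_n_sum_left using ur by simp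
  then have "sqnorm_n N (\<lambda>i. q i + r i) = sqnorm_n N q + sqnorm_n N r"
    by (rule sqnorm_n_add_orthogonal)
  moreover have "(\<lambda>i. q i + r i) = v" by (simp add: r_def)
  moreover have "sqnorm_n N q = (\<Sum>k<m. (cmod (inner_n N (u k) v))\<^sup>2)"
    unfolding q_def by (rule sqnorm_n_orthonormal_combination[OF assms])
  ultimately show ?thesis using sqnorm_n_nonneg[of N r] by simp
qed

text \<open>The substitute for rotation invariance: a linear form in the coordinates along
  \<open>u\<close> is a linear form in \<open>v\<close> itself with coefficients of equal norm, and
  the Gaussian transforms see only this norm.\<close>

lemma orthonormal_linear_form:
  assumes "orthonormal_n N m u"
  obtains q where "\<And>v. (\<Sum>k<m. p k * inner_n N (u k) v) = (\<Sum>i<N. q i * v i)"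
    "(\<Sum>i<N. (cmod (q i))\<^sup>2) = (\<Sum>k<m. (cmod (p k))\<^sup>2)"
proof
  let ?q = "\<lambda>i. \<Sum>k<m. p k * cnj (u k i)"
  show "(\<Sum>k<m. p k * inner_n N (u k) v) = (\<Sum>i<N. ?q i * v i)" for v
    unfolding inner_n_def by (simp add: sum_distrib_left sum_distrib_right mult_ac) (rule sum.swap)
  have "?q i = cnj (\<Sum>k<m. cnj (p k) * u k i)" for i by simp
  then have "(\<Sum>i<N. (cmod (?q i))\<^sup>2) = sqnorm_n N (\<lambda>i. \<Sum>k<m. cnj (p k) * u k i)"
    unfolding sqnorm_n_def by (simp only: complex_mod_cnj)
  then show "(\<Sum>i<N. (cmod (?q i))\<^sup>2) = (\<Sum>k<m. (cmod (p k))\<^sup>2)"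
    unfolding sqnorm_n_orthonormal_combination[OF assms] by simp
qed

definition independent_cols :: "nat \<Rightarrow> 'j set \<Rightarrow> ('j \<Rightarrow> nat \<Rightarrow> complex) \<Rightarrow> bool" where
  "independent_cols N J b \<longleftrightarrow>
     (\<forall>z. (\<forall>i<N. (\<Sum>j\<in>J. z j * b j i) = 0) \<longrightarrow> (\<forall>j\<in>J. z j = 0))"

text \<open>The \<open>N\<close> columns and complement vectors are independent, so together with \<open>v\<close> they admit a
  dependence in which \<open>v\<close> has a nonzero coefficient.\<close>

lemma residual_attained:
  fixes b :: "'j \<Rightarrow> nat \<Rightarrow> complex"
  assumes "finite J" "card J + m = N" and ind: "independent_cols N J b"
    and u: "orthonormal_n N m u" "\<forall>k<m. \<forall>j\<in>J. inner_n N (u k) (b j) = 0"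
  shows "\<exists>z. sqnorm_n N (\<lambda>i. v i + (\<Sum>j\<in>J. z j * b j i)) = (\<Sum>k<m. (cmod (inner_n N (u k) v))\<^sup>2)"
proof -
  \<comment> \<open>\<open>None\<close> stands for \<open>v\<close>, \<open>Inl k\<close> for a
    complement vector and \<open>Inr j\<close> for a column: \<open>N + 1\<close> vectors with
    \<open>N\<close> coordinates.\<close>
  let ?S = "insert None (Some ` (Inl ` {..<m} \<union> Inr ` J)) :: (nat + 'j) option set"
  let ?c = "\<lambda>i s. case s of None \<Rightarrow> v i | Some (Inl k) \<Rightarrow> u k i | Some (Inr j) \<Rightarrow> b j i"
  have disj: "Inl ` {..<m} \<inter> Inr ` J = ({} :: (nat + 'j) set)" by auto
  have "card ?S = Suc N"
    using assms(1,2) by (simp add: card_image card_Un_disjoint[OF _ _ disj])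
  then obtain w where w: "\<exists>s\<in>?S. w s \<noteq> 0" "\<forall>i\<in>{..<N}. (\<Sum>s\<in>?S. ?c i s * w s) = 0"
    using underdetermined_solution[of "{..<N}" ?S ?c] assms(1) by auto
  define a where "a = w None"
  define p where "p = (\<lambda>k. w (Some (Inl k)))"
  define z where "z = (\<lambda>j. w (Some (Inr j)))"
  define q where "q = (\<lambda>i. \<Sum>k<m. p k * u k i)"
  define y where "y = (\<lambda>i. \<Sum>j\<in>J. z j * b j i)"
  have "(\<Sum>s\<in>?S. ?c i s * w s) = a * v i + q i + y i" for i
    using assms(1) unfolding a_def q_def y_def p_def z_def
    by (simp add: sum.reindex sum.union_disjoint[OF _ _ disj] mult_ac)
  then have dep: "a * v i + q i + y i = 0" if "i < N" for i
    using w(2) that by auto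
  have uy: "inner_n N (u k) y = 0" if "k < m" for k
    unfolding y_def inner_n_sum using u(2) that by simp
  have qy: "inner_n N q y = 0"
    unfolding q_def inner_n_sum_left using uy by simp
  have uq: "inner_n N (u k) q = p k" if "k < m" for k
    unfolding q_def by (rule inner_n_orthonormal_combination[OF u(1) that])
  have up: "a * inner_n N (u k) v + p k = 0" if "k < m" for k
  proof -
    have "inner_n N (u k) (\<lambda>i. (a * v i + q i) + y i) = 0"
      unfolding inner_n_def using dep by simp
    then show ?thesis unfolding inner_n_add inner_n_cmult uq[OF that] uy[OF that] by simp
  qed
  \<comment> \<open>With \<open>a = 0\<close>, pairing with \<open>u k\<close> kills the complement
    coefficients, and a dependence among the columns alone remains.\<close>
  have "a \<noteq> 0"
  proof
    assume a: "a = 0"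
    then have p0: "p k = 0" if "k < m" for k using up[OF that] by simp
    then have "q = (\<lambda>_. 0)" unfolding q_def by simp
    then have "\<forall>i<N. y i = 0" using dep a by simp
    then have "\<forall>j\<in>J. z j = 0" using ind unfolding independent_cols_def y_def by blast
    then have "\<forall>s\<in>?S. w s = 0" using a p0 unfolding a_def p_def z_def by auto
    then show False using w(1) by blast
  qed
  \<comment> \<open>Dividing the dependence by \<open>a\<close> shows that this combination of
    columns moves \<open>v\<close> exactly onto its projection along the \<open>u k\<close>.\<close>
  have "sqnorm_n N (\<lambda>i. v i + (\<Sum>j\<in>J. (z j / a) * b j i)) = sqnorm_n N (\<lambda>i. \<Sum>k<m. inner_n N (u k) v * u k i)"
    unfolding sqnorm_n_def
  proof (intro sum.cong refl)
    fix i assume "i \<in> {..<N}"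
    then have "a * v i + y i = - q i" using dep[of i] by (simp add: algebra_simps add_eq_0_iff)
    moreover have "(\<Sum>j\<in>J. (z j / a) * b j i) = y i / a"
      unfolding y_def by (simp add: sum_divide_distrib)
    moreover have "q i = - a * (\<Sum>k<m. inner_n N (u k) v * u k i)"
    proof -
      have "q i = (\<Sum>k<m. (- a * inner_n N (u k) v) * u k i)"
        unfolding q_def using up by (intro sum.cong refl arg_cong2[of _ _ _ _ "(*)"]) (auto simp: add_eq_0_iff)
      then show ?thesis by (simp add: sum_distrib_left mult_ac sum_negf)
    qed
    ultimately have "a * (v i + (\<Sum>j\<in>J. (z j / a) * b j i)) = a * (\<Sum>k<m. inner_n N (u k) v * u k i)"
      using \<open>a \<noteq> 0\<close> by (simp only: distrib_left) simp
    then have "v i + (\<Sum>j\<in>J. (z j / a) * b j i) = (\<Sum>k<m. inner_n N (u k) v * u k i)"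
      using \<open>a \<noteq> 0\<close> by (metis mult_left_cancel)
    then show "(cmod (v i + (\<Sum>j\<in>J. (z j / a) * b j i)))\<^sup>2 = (cmod (\<Sum>k<m. inner_n N (u k) v * u k i))\<^sup>2"
      by simp
  qed
  then have "sqnorm_n N (\<lambda>i. v i + (\<Sum>j\<in>J. (z j / a) * b j i)) = (\<Sum>k<m. (cmod (inner_n N (u k) v))\<^sup>2)"
    by (simp only: sqnorm_n_orthonormal_combination[OF u(1)])
  then show ?thesis by (rule exI[where x = "\<lambda>j. z j / a"])
qed

section \<open>The least-residual decoder\<close>

text \<open>The squared distance from \<open>y\<close> to the span of the columns in
  \<open>J\<close>. As an infimum it makes sense for dependent columns too, without a projection
  matrix.\<close>

definition residual :: "nat \<Rightarrow> nat set \<Rightarrow> (nat \<times> nat \<Rightarrow> complex) \<Rightarrow> (nat \<Rightarrow> complex) \<Rightarrow> real" where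
  "residual N J A y = (INF z. sqnorm_n N (\<lambda>i. y i - (\<Sum>j\<in>J. A (i, j) * z j)))"

lemma bdd_below_residual: "bdd_below (range (\<lambda>z. sqnorm_n N (\<lambda>i. y i - (\<Sum>j\<in>J. A (i, j) * z j))))"
  by (intro bdd_belowI[of _ 0]) (auto simp: sqnorm_n_nonneg)

lemma residual_le: "residual N J A y \<le> sqnorm_n N (\<lambda>i. y i - (\<Sum>j\<in>J. A (i, j) * z j))"
  unfolding residual_def by (rule cINF_lower[OF bdd_below_residual]) simp

lemma residual_ge:
  "(\<And>z. c \<le> sqnorm_n N (\<lambda>i. y i - (\<Sum>j\<in>J. A (i, j) * z j))) \<Longrightarrow> c \<le> residual N J A y"
  unfolding residual_def by (rule cINF_greatest) auto

text \<open>Only coordinates below \<open>N\<close> are read, so \<open>observation\<close>,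
  restricted to them, can be replaced by its unrestricted formula.\<close>

lemma residual_cong:
  assumes "\<And>i j. i < N \<Longrightarrow> j \<in> J \<Longrightarrow> A (i, j) = B (i, j)" "\<And>i. i < N \<Longrightarrow> y i = w i"
  shows "residual N J A y = residual N J B w"
  unfolding residual_def sqnorm_n_def using assms by (auto intro!: INF_cong sum.cong)

text \<open>The infimum over uncountably many \<open>z\<close> reduces to a countable dense set: the
  objective is continuous in \<open>z\<close> for the product topology, so if it is below
  \<open>c\<close> anywhere, it is so on a nonempty open set.\<close>

lemma measurable_residual:
  assumes J: "finite J"
    and A: "\<And>i j. i < N \<Longrightarrow> j \<in> J \<Longrightarrow> (\<lambda>w. A w (i, j)) \<in> borel_measurable \<Omega>"
    and y: "\<And>i. i < N \<Longrightarrow> (\<lambda>w. y w i) \<in> borel_measurable \<Omega>"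
  shows "(\<lambda>w. residual N J (A w) (y w)) \<in> borel_measurable \<Omega>"
proof (rule borel_measurableI_less)
  fix c :: real
  let ?f = "\<lambda>w z. sqnorm_n N (\<lambda>i. y w i - (\<Sum>j\<in>J. A w (i, j) * z j))"
  obtain Z :: "(nat \<Rightarrow> complex) set" where Z: "countable Z"
      "\<And>X. open X \<Longrightarrow> X \<noteq> {} \<Longrightarrow> \<exists>z\<in>Z. z \<in> X"
    using countable_dense_exists by (metis (no_types))
  have "residual N J (A w) (y w) < c \<longleftrightarrow> (\<exists>z\<in>Z. ?f w z < c)" for w
  proof
    assume "residual N J (A w) (y w) < c"
    then obtain z where "?f w z < c"
      unfolding residual_def by (subst (asm) cINF_less_iff[OF _ bdd_below_residual]) auto
    moreover have "continuous_on UNIV (?f w)"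
      unfolding sqnorm_n_def
      by (intro continuous_intros continuous_on_product_coordinates)
    then have "open {z. ?f w z < c}"
      by (intro open_Collect_less) auto
    ultimately show "\<exists>z\<in>Z. ?f w z < c" using Z(2)[of "{z. ?f w z < c}"] by auto
  next
    assume "\<exists>z\<in>Z. ?f w z < c"
    then show "residual N J (A w) (y w) < c" using residual_le le_less_trans by blast
  qed
  then have "{w \<in> space \<Omega>. residual N J (A w) (y w) < c} = (\<Union>z\<in>Z. {w \<in> space \<Omega>. ?f w z < c})"
    by auto
  moreover have "{w \<in> space \<Omega>. ?f w z < c} \<in> sets \<Omega>" for z
  proof -
    have "(\<lambda>w. ?f w z) \<in> borel_measurable \<Omega>"
      unfolding sqnorm_n_def using J A y
      by (intro borel_measurable_sum borel_measurable_power borel_measurable_norm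
          borel_measurable_diff borel_measurable_times) auto
    then show ?thesis by measurable
  qed
  ultimately show "{w \<in> space \<Omega>. residual N J (A w) (y w) < c} \<in> sets \<Omega>"
    using Z(1) by auto
qed

text \<open>An argmin with ties decided by list order. A rejected head is strictly beaten by a later
  element, so passing to the tail loses no minimum; the recursion also yields measurability from
  finitely many comparisons.\<close>

fun pick_min :: "('j \<Rightarrow> real) \<Rightarrow> 'j list \<Rightarrow> 'j" where
  "pick_min r [] = undefined"
| "pick_min r (J # Js) = (if \<forall>K\<in>set Js. r J \<le> r K then J else pick_min r Js)"

lemma pick_min_correct:
  "Js \<noteq> [] \<Longrightarrow> pick_min r Js \<in> set Js \<and> (\<forall>K\<in>set Js. r (pick_min r Js) \<le> r K)"
proof (induction Js)
  case (Cons J Js)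
  show ?case
  proof (cases "\<forall>K\<in>set Js. r J \<le> r K")
    case False
    then obtain K where K: "K \<in> set Js" "r K < r J" by (auto simp: not_le)
    then have "Js \<noteq> []" by auto
    then have "pick_min r Js \<in> set Js" "\<forall>K\<in>set Js. r (pick_min r Js) \<le> r K" using Cons.IH by auto
    then show ?thesis using K False by (auto intro: order_trans less_imp_le dest: bspec)
  qed auto
qed simp

lemma measurable_pick_min:
  assumes "\<And>J. J \<in> set Js \<Longrightarrow> (\<lambda>w. r w J) \<in> borel_measurable \<Omega>"
  shows "(\<lambda>w. pick_min (r w) Js) \<in> \<Omega> \<rightarrow>\<^sub>M count_space UNIV"
  using assms
proof (induction Js)
  case (Cons J Js)
  have [measurable]: "(\<lambda>w. r w K) \<in> borel_measurable \<Omega>" if "K \<in> set (J # Js)" for K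
    using Cons.prems that by blast
  have [measurable]: "(\<lambda>w. pick_min (r w) Js) \<in> \<Omega> \<rightarrow>\<^sub>M count_space UNIV"
    using Cons by simp
  have [measurable]: "Measurable.pred \<Omega> (\<lambda>w. \<forall>K\<in>set Js. r w J \<le> r w K)"
    by (intro pred_intros_finite) auto
  show ?case unfolding pick_min.simps by measurable
qed simp

section \<open>The decoder on supports of size \<open>L\<close>\<close>

definition L_subsets :: "nat \<Rightarrow> nat \<Rightarrow> nat set set" where
  "L_subsets M L = {J. J \<subseteq> {..<M} \<and> card J = L}"

lemma finite_L_subsets: "finite (L_subsets M L)"
  unfolding L_subsets_def by (rule finite_subset[of _ "Pow {..<M}"]) auto

text \<open>Any fixed enumeration serves; it only determines how ties are broken.\<close>

definition L_subset_list :: "nat \<Rightarrow> nat \<Rightarrow> nat set list" where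
  "L_subset_list M L = (SOME Js. set Js = L_subsets M L)"

lemma set_L_subset_list: "set (L_subset_list M L) = L_subsets M L"
  unfolding L_subset_list_def using finite_list[OF finite_L_subsets] by (rule someI_ex)

definition min_residual_support ::
  "nat \<Rightarrow> nat \<Rightarrow> nat \<Rightarrow> (nat \<times> nat \<Rightarrow> complex) \<Rightarrow> (nat \<Rightarrow> complex) \<Rightarrow> nat set" where
  "min_residual_support N M L A y = pick_min (\<lambda>J. residual N J A y) (L_subset_list M L)"

text \<open>The value 1 is a placeholder, as the 0-1 loss reads only the support. The restriction to
  \<open>{..<M}\<close> places the estimate in the space of the product measure.\<close>

definition min_residual_decoder ::
  "nat \<Rightarrow> nat \<Rightarrow> nat \<Rightarrow> (nat \<times> nat \<Rightarrow> complex) \<Rightarrow> (nat \<Rightarrow> complex) \<Rightarrow> nat \<Rightarrow> complex" where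
  "min_residual_decoder N M L A y =
     (\<lambda>i\<in>{..<M}. if i \<in> min_residual_support N M L A y then 1 else 0)"

lemma min_residual_support:
  assumes "L \<le> M"
  shows "min_residual_support N M L A y \<in> L_subsets M L"
    and "J \<in> L_subsets M L \<Longrightarrow> residual N (min_residual_support N M L A y) A y \<le> residual N J A y"
proof -
  have "{..<L} \<in> L_subsets M L" using assms by (auto simp: L_subsets_def)
  then have "L_subset_list M L \<noteq> []" using set_L_subset_list[of M L] by (metis empty_iff list.set(1))
  from pick_min_correct[OF this, of "\<lambda>J. residual N J A y"]
  show "min_residual_support N M L A y \<in> L_subsets M L"
    and "J \<in> L_subsets M L \<Longrightarrow> residual N (min_residual_support N M L A y) A y \<le> residual N J A y"
    unfolding min_residual_support_def set_L_subset_list by auto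
qed

lemma vsupp_min_residual_decoder:
  assumes "L \<le> M"
  shows "vsupp M (min_residual_decoder N M L A y) = min_residual_support N M L A y"
  using min_residual_support(1)[OF assms, of N A y]
  by (auto simp: vsupp_def min_residual_decoder_def L_subsets_def)

lemma sparse_decoder_min_residual:
  assumes "L \<le> M"
  shows "sparse_decoder N M L (min_residual_decoder N M L)"
proof -
  let ?P = "Pi\<^sub>M ({..<N} \<times> {..<M}) (\<lambda>_. borel :: complex measure) \<Otimes>\<^sub>M Pi\<^sub>M {..<N} (\<lambda>_. borel :: complex measure)"
  have 1: "(\<lambda>p. residual N J (fst p) (snd p)) \<in> borel_measurable ?P" if "J \<in> L_subsets M L" for J
  proof (rule measurable_residual)
    show "finite J" using that by (auto simp: L_subsets_def intro: finite_subset)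
    show "(\<lambda>p. fst p (i, j)) \<in> borel_measurable ?P" if "i < N" "j \<in> J" for i j
      using that \<open>J \<in> L_subsets M L\<close>
      by (intro measurable_compose[OF measurable_fst] measurable_component_singleton)
        (auto simp: L_subsets_def)
    show "(\<lambda>p. snd p i) \<in> borel_measurable ?P" if "i < N" for i
      using that by (intro measurable_compose[OF measurable_snd] measurable_component_singleton) auto
  qed
  have [measurable]: "(\<lambda>p. min_residual_support N M L (fst p) (snd p)) \<in> ?P \<rightarrow>\<^sub>M count_space UNIV"
    unfolding min_residual_support_def
    by (rule measurable_pick_min) (use 1 in \<open>simp add: set_L_subset_list\<close>)
  have "(\<lambda>(A, y). min_residual_decoder N M L A y) \<in> ?P \<rightarrow>\<^sub>M Pi\<^sub>M {..<M} (\<lambda>_. borel)"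
    unfolding min_residual_decoder_def case_prod_beta
  proof (rule measurable_restrict)
    fix i
    have [measurable]: "Measurable.pred ?P (\<lambda>p. i \<in> min_residual_support N M L (fst p) (snd p))"
      by (rule measurable_compose[where g = "\<lambda>S. i \<in> S" and N = "count_space UNIV"]) auto
    show "(\<lambda>p. if i \<in> min_residual_support N M L (fst p) (snd p) then 1 else 0 :: complex) \<in> borel_measurable ?P"
      by measurable
  qed
  moreover have "l0norm M (min_residual_decoder N M L A y) = L" for A y
    using min_residual_support(1)[OF assms, of N A y]
    unfolding l0norm_def vsupp_min_residual_decoder[OF assms] by (simp add: L_subsets_def)
  ultimately show ?thesis unfolding sparse_decoder_def by blast
qed

section \<open>Residuals of Gaussian matrices\<close>

lemma (in pair_prob_space) integral_cis_pair:
  assumes [measurable]: "f \<in> borel_measurable M1" "g \<in> borel_measurable M2"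
  shows "(LINT p|(M1 \<Otimes>\<^sub>M M2). cis (f (fst p) + g (snd p)))
     = (LINT x|M1. cis (f x)) * (LINT y|M2. cis (g y))"
proof -
  have "(LINT p|(M1 \<Otimes>\<^sub>M M2). cis (f (fst p) + g (snd p)))
      = (LINT x|M1. LINT y|M2. cis (f (fst (x, y)) + g (snd (x, y))))"
    by (intro integral_fst'[symmetric] integrable_const_bound[where B=1]) auto
  then show ?thesis by (simp flip: cis_mult)
qed

text \<open>The exponent is a linear form in the matrix entries with coefficients
  \<open>q i * x j\<close>, whose squared norm factorises. Hence the combined columns behave like
  one Gaussian vector with variance the sum of the \<open>(cmod (x j))\<^sup>2\<close>.\<close>

lemma gaussian_columns_char:
  fixes K :: "'j set" and N :: nat
  assumes "finite K"
  shows "(LINT C|gauss_vec 1 ({..<N} \<times> K). cis (Re (\<Sum>i<N. q i * (\<Sum>j\<in>K. C (i, j) * x j))))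
    = of_real (exp (- (\<Sum>j\<in>K. (cmod (x j))\<^sup>2) / 4 * (\<Sum>i<N. (cmod (q i))\<^sup>2)))"
proof -
  have "(\<Sum>i<N. q i * (\<Sum>j\<in>K. C (i, j) * x j)) = (\<Sum>p\<in>{..<N} \<times> K. (q (fst p) * x (snd p)) * C p)"
    for C :: "nat \<times> 'j \<Rightarrow> complex"
    by (simp add: sum_distrib_left mult_ac sum.cartesian_product case_prod_beta)
  moreover have "(\<Sum>p\<in>{..<N} \<times> K. (cmod (q (fst p) * x (snd p)))\<^sup>2)
      = (\<Sum>j\<in>K. (cmod (x j))\<^sup>2) * (\<Sum>i<N. (cmod (q i))\<^sup>2)"
    by (subst mult.commute) (simp add: sum_product sum.cartesian_product case_prod_beta norm_mult power_mult_distrib)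
  ultimately show ?thesis
    using assms by (simp only: gauss_vec_char[OF zero_less_one finite_cartesian_product[OF finite_lessThan assms]]) simp
qed

lemma measurable_residual_observation:
  assumes \<eta>: "\<And>i. i < N \<Longrightarrow> (\<lambda>w. \<eta> w i) \<in> borel_measurable \<Omega>" and J: "J \<subseteq> {..<M}"
  shows "(\<lambda>p. residual N J (fst p) (\<lambda>i. (\<Sum>j<M. fst p (i, j) * x j) + \<eta> (snd p) i))
    \<in> borel_measurable (gaussian_matrix N M \<Otimes>\<^sub>M \<Omega>)"
proof -
  have A[measurable]: "(\<lambda>p. fst p (i, j)) \<in> borel_measurable (gaussian_matrix N M \<Otimes>\<^sub>M \<Omega>)"
    if "i < N" "j < M" for i j
    using that unfolding gaussian_matrix_def
    by (intro measurable_compose[OF measurable_fst]) (auto intro!: measurable_component_singleton)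
  have w[measurable]: "(\<lambda>p. \<eta> (snd p) i) \<in> borel_measurable (gaussian_matrix N M \<Otimes>\<^sub>M \<Omega>)"
    if "i < N" for i
    using \<eta>[OF that] by measurable
  show ?thesis
    using J finite_subset[OF J] by (intro measurable_residual A) auto
qed

text \<open>The noise is abstracted to a random vector \<open>\<eta>\<close> known only through its characteristic function;
  \<open>\<eta> = 0\<close> is used for the rank of a Gaussian matrix.\<close>

lemma residual_laplace_bound:
  fixes \<eta> :: "'w \<Rightarrow> nat \<Rightarrow> complex"
  assumes "prob_space \<Omega>" and \<eta>: "\<And>i. i < N \<Longrightarrow> (\<lambda>w. \<eta> w i) \<in> borel_measurable \<Omega>"
    and char: "\<And>q. (LINT w|\<Omega>. cis (Re (\<Sum>i<N. q i * \<eta> w i)))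
       = of_real (exp (- \<tau> / 4 * (\<Sum>i<N. (cmod (q i))\<^sup>2)))"
    and "\<tau> \<ge> 0" "s \<ge> 0" "J \<subseteq> {..<M}" "card J + m \<le> N"
  shows "(\<integral>\<^sup>+A. (\<integral>\<^sup>+w. ennreal (exp (- s * residual N J A (\<lambda>i. (\<Sum>j<M. A (i, j) * x j) + \<eta> w i))) \<partial>\<Omega>)
            \<partial>gaussian_matrix N M)
    \<le> ennreal ((1 / (1 + s * ((\<Sum>j\<in>{..<M} - J. (cmod (x j))\<^sup>2) + \<tau>))) ^ m)"
proof -
  interpret O: prob_space \<Omega> by fact
  interpret S: product_sigma_finite "\<lambda>_::nat \<times> nat. complex_normal 1"
    by (simp add: product_sigma_finite_complex_normal)
  define K where "K = {..<M} - J"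
  \<comment> \<open>The entries of the columns in \<open>J\<close>, and below those of the remaining
    columns: the product measure is integrated in these two blocks.\<close>
  define IB where "IB = {..<N} \<times> J"
  define IC where "IC = {..<N} \<times> K"
  have fin: "finite J" "finite K" "finite IB" "finite IC"
    using assms(6) unfolding K_def IB_def IC_def by (auto intro: finite_subset)
  have disj: "IB \<inter> IC = {}" "{..<N} \<times> {..<M} = IB \<union> IC"
    using assms(6) unfolding IB_def IC_def K_def by auto
  let ?obs = "\<lambda>A w i. (\<Sum>j<M. A (i, j) * x j) + \<eta> w i"
  define f where "f = (\<lambda>A. \<integral>\<^sup>+w. ennreal (exp (- s * residual N J A (?obs A w))) \<partial>\<Omega>)"
  define G where "G = (gauss_vec 1 IC :: (nat \<times> nat \<Rightarrow> complex) measure)"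
  interpret G: prob_space G unfolding G_def by (simp add: prob_space_gauss_vec)
  interpret GO: pair_prob_space G \<Omega> ..
  let ?GM = "gauss_vec 1 (IB \<union> IC) :: (nat \<times> nat \<Rightarrow> complex) measure"
  have [measurable]: "(\<lambda>p. residual N J (fst p) (?obs (fst p) (snd p))) \<in> borel_measurable (?GM \<Otimes>\<^sub>M \<Omega>)"
    using measurable_residual_observation[where N = N and \<eta> = \<eta> and \<Omega> = \<Omega> and x = x, OF \<eta> assms(6)]
    unfolding gaussian_matrix_def disj(2) by simp
  have f: "f \<in> borel_measurable ?GM"
    unfolding f_def by (intro O.borel_measurable_nn_integral) (simp add: case_prod_beta)
  \<comment> \<open>Conditioning on the columns in \<open>J\<close>: the vectors \<open>u\<close>
    are chosen from \<open>B\<close> alone, hence are constants for \<open>C\<close> and the noise,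
    and the bound is the same for every \<open>B\<close>.\<close>
  have inner: "(\<integral>\<^sup>+C. f (merge IB IC (B, C)) \<partial>G)
     \<le> ennreal ((1 / (1 + s * ((\<Sum>j\<in>K. (cmod (x j))\<^sup>2) + \<tau>))) ^ m)" for B
  proof -
    obtain u where u: "orthonormal_n N m u" "\<forall>k<m. \<forall>j\<in>J. inner_n N (u k) (\<lambda>i. B (i, j)) = 0"
      using orthonormal_complement[OF fin(1) assms(7), of "\<lambda>j i. B (i, j)"] by auto
    define g where "g = (\<lambda>C w i. (\<Sum>j\<in>K. C (i, j) * x j) + \<eta> w i)"
    define W where "W = (\<lambda>k p. inner_n N (u k) (g (fst p) (snd p)))"
    have mg[measurable]: "(\<lambda>p. g (fst p) (snd p) i) \<in> borel_measurable (G \<Otimes>\<^sub>M \<Omega>)" if "i < N" for i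
    proof -
      have "(\<lambda>p. fst p (i, j)) \<in> borel_measurable (G \<Otimes>\<^sub>M \<Omega>)" if "j \<in> K" for j
        unfolding G_def using that \<open>i < N\<close>
        by (intro measurable_compose[OF measurable_fst]) (auto intro!: measurable_component_singleton simp: IC_def)
      moreover have "(\<lambda>p. \<eta> (snd p) i) \<in> borel_measurable (G \<Otimes>\<^sub>M \<Omega>)"
        using \<eta>[OF \<open>i < N\<close>] by measurable
      ultimately show ?thesis unfolding g_def
        by (intro borel_measurable_add borel_measurable_sum borel_measurable_times) auto
    qed
    have mW[measurable]: "W k \<in> borel_measurable (G \<Otimes>\<^sub>M \<Omega>)" for k
      unfolding W_def inner_n_def by (intro borel_measurable_sum borel_measurable_times) auto
    have res: "(\<Sum>k<m. (cmod (W k (C, w)))\<^sup>2) \<le> residual N J (merge IB IC (B, C)) (?obs (merge IB IC (B, C)) w)" for C w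
    proof (rule residual_ge)
      fix z
      let ?A = "merge IB IC (B, C)"
      let ?v = "\<lambda>i. ?obs ?A w i - (\<Sum>j\<in>J. ?A (i, j) * z j)"
      \<comment> \<open>A change of \<open>z\<close> only alters coefficients of columns in
        \<open>J\<close>, to which each \<open>u k\<close> is orthogonal; the coordinates along
        \<open>u\<close> are therefore the same for all \<open>z\<close>.\<close>
      have v: "?v i = g C w i + (\<Sum>j\<in>J. (x j - z j) * B (i, j))" if "i < N" for i
      proof -
        have AJ: "?A (i, j) = B (i, j)" if "j \<in> J" for j
          using that \<open>i < N\<close> by (auto simp: merge_def IB_def)
        have AK: "?A (i, j) = C (i, j)" if "j \<in> K" for j
          using that \<open>i < N\<close> by (auto simp: merge_def IB_def IC_def K_def)
        have "(\<Sum>j<M. ?A (i, j) * x j) = (\<Sum>j\<in>J. ?A (i, j) * x j) + (\<Sum>j\<in>K. ?A (i, j) * x j)"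
          unfolding K_def using assms(6) by (subst sum.subset_diff[of J]) (auto simp: add.commute)
        then show ?thesis
          by (simp add: AJ AK g_def algebra_simps sum_subtractf)
      qed
      have "inner_n N (u k) ?v = W k (C, w)" if "k < m" for k
      proof -
        have "inner_n N (u k) ?v = inner_n N (u k) (\<lambda>i. g C w i + (\<Sum>j\<in>J. (x j - z j) * B (i, j)))"
          unfolding inner_n_def using v by (intro sum.cong refl) (simp only: lessThan_iff)
        also have "\<dots> = W k (C, w)"
          unfolding inner_n_add inner_n_sum W_def using u(2) that by simp
        finally show ?thesis .
      qed
      then show "(\<Sum>k<m. (cmod (W k (C, w)))\<^sup>2) \<le> sqnorm_n N ?v"
        using bessel_inequality[OF u(1), of ?v] by simp
    qed
    have charW: "(LINT p|(G \<Otimes>\<^sub>M \<Omega>). cis (Re (\<Sum>k<m. p' k * W k p)))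
      = of_real (exp (- ((\<Sum>j\<in>K. (cmod (x j))\<^sup>2) + \<tau>) / 4 * (\<Sum>k<m. (cmod (p' k))\<^sup>2)))" for p'
    proof -
      obtain q where q: "\<And>v. (\<Sum>k<m. p' k * inner_n N (u k) v) = (\<Sum>i<N. q i * v i)"
          "(\<Sum>i<N. (cmod (q i))\<^sup>2) = (\<Sum>k<m. (cmod (p' k))\<^sup>2)"
        using orthonormal_linear_form[OF u(1), of p'] by blast
      have "(\<Sum>k<m. p' k * W k p) = (\<Sum>i<N. q i * (\<Sum>j\<in>K. fst p (i, j) * x j)) + (\<Sum>i<N. q i * \<eta> (snd p) i)" for p
        unfolding W_def q(1) g_def by (simp add: distrib_left sum.distrib)
      then have "(LINT p|(G \<Otimes>\<^sub>M \<Omega>). cis (Re (\<Sum>k<m. p' k * W k p)))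
        = (LINT p|(G \<Otimes>\<^sub>M \<Omega>). cis (Re (\<Sum>i<N. q i * (\<Sum>j\<in>K. fst p (i, j) * x j)) + Re (\<Sum>i<N. q i * \<eta> (snd p) i)))"
        by simp
      also have "\<dots> = (LINT C|G. cis (Re (\<Sum>i<N. q i * (\<Sum>j\<in>K. C (i, j) * x j))))
          * (LINT w|\<Omega>. cis (Re (\<Sum>i<N. q i * \<eta> w i)))"
      proof (rule GO.integral_cis_pair)
        show "(\<lambda>C. Re (\<Sum>i<N. q i * (\<Sum>j\<in>K. C (i, j) * x j))) \<in> borel_measurable G"
        proof -
          have [measurable]: "(\<lambda>C. C (i, j)) \<in> borel_measurable G" if "i < N" "j \<in> K" for i j
            unfolding G_def using that by (auto intro!: measurable_component_singleton simp: IC_def)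
          show ?thesis by measurable
        qed
        show "(\<lambda>w. Re (\<Sum>i<N. q i * \<eta> w i)) \<in> borel_measurable \<Omega>"
          using \<eta> by measurable
      qed
      also have "\<dots> = of_real (exp (- ((\<Sum>j\<in>K. (cmod (x j))\<^sup>2) + \<tau>) / 4 * (\<Sum>i<N. (cmod (q i))\<^sup>2)))"
        unfolding G_def IC_def gaussian_columns_char[OF fin(2)] char
        by (simp add: field_simps flip: of_real_mult exp_add)
      finally show ?thesis unfolding q(2) .
    qed
    have "(\<integral>\<^sup>+C. f (merge IB IC (B, C)) \<partial>G)
       \<le> (\<integral>\<^sup>+C. \<integral>\<^sup>+w. ennreal (exp (- s * (\<Sum>k<m. (cmod (W k (C, w)))\<^sup>2))) \<partial>\<Omega> \<partial>G)"
      unfolding f_def using res assms(5)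
      by (intro nn_integral_mono ennreal_leI) (simp add: mult_left_mono)
    also have "\<dots> = (\<integral>\<^sup>+p. ennreal (exp (- s * (\<Sum>k<m. (cmod (W k p))\<^sup>2))) \<partial>(G \<Otimes>\<^sub>M \<Omega>))"
      by (subst O.nn_integral_fst) auto
    also have "\<dots> = ennreal ((1 / (1 + s * ((\<Sum>j\<in>K. (cmod (x j))\<^sup>2) + \<tau>))) ^ m)"
      using assms(4,5)
      by (intro laplace_transform_sum_squares GO.prob_space_axioms charW mW) (auto intro!: add_nonneg_nonneg sum_nonneg)
    finally show ?thesis .
  qed
  interpret B: prob_space "gauss_vec 1 IB :: (nat \<times> nat \<Rightarrow> complex) measure"
    by (simp add: prob_space_gauss_vec)
  have "integral\<^sup>N (gaussian_matrix N M) f = integral\<^sup>N ?GM f"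
    unfolding gaussian_matrix_def disj(2) ..
  also have "\<dots> = (\<integral>\<^sup>+B. (\<integral>\<^sup>+C. f (merge IB IC (B, C)) \<partial>G) \<partial>gauss_vec 1 IB)"
    unfolding G_def by (rule S.product_nn_integral_fold[OF disj(1) fin(3,4) f])
  also have "\<dots> \<le> (\<integral>\<^sup>+B. ennreal ((1 / (1 + s * ((\<Sum>j\<in>K. (cmod (x j))\<^sup>2) + \<tau>))) ^ m) \<partial>gauss_vec 1 IB)"
    by (intro nn_integral_mono inner)
  also have "\<dots> = ennreal ((1 / (1 + s * ((\<Sum>j\<in>K. (cmod (x j))\<^sup>2) + \<tau>))) ^ m)"
    by (simp add: B.emeasure_space_1)
  finally show ?thesis unfolding f_def K_def .
qed

section \<open>Tail bounds for true and wrong supports\<close>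

lemma prob_space_gaussian_matrix: "prob_space (gaussian_matrix N M)"
  unfolding gaussian_matrix_def by (simp add: prob_space_gauss_vec)

lemma prob_space_gaussian_noise: "\<nu> > 0 \<Longrightarrow> prob_space (gaussian_noise \<nu> N)"
  unfolding gaussian_noise_def by (simp add: prob_space_gauss_vec)

lemma measurable_gaussian_noise: "i < N \<Longrightarrow> (\<lambda>n. n i) \<in> borel_measurable (gaussian_noise \<nu> N)"
  unfolding gaussian_noise_def by simp

lemma residual_observation:
  "residual N J A (observation N M A x n) = residual N J A (\<lambda>i. (\<Sum>j<M. A (i, j) * x j) + n i)"
  by (rule residual_cong) (auto simp: observation_def)

lemma measurable_residual_gaussian:
  "J \<subseteq> {..<M} \<Longrightarrow> (\<lambda>p. residual N J (fst p) (\<lambda>i. (\<Sum>j<M. fst p (i, j) * x j) + snd p i))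
    \<in> borel_measurable (gaussian_matrix N M \<Otimes>\<^sub>M gaussian_noise \<nu> N)"
  by (rule measurable_residual_observation[where \<eta> = "\<lambda>n. n"]) (simp_all add: measurable_gaussian_noise)

lemma measurable_residual_noise:
  assumes "A \<in> space (gaussian_matrix N M)" "J \<subseteq> {..<M}"
  shows "(\<lambda>n. residual N J A (observation N M A x n)) \<in> borel_measurable (gaussian_noise \<nu> N)"
proof -
  have "(\<lambda>n. (A, n)) \<in> gaussian_noise \<nu> N \<rightarrow>\<^sub>M gaussian_matrix N M \<Otimes>\<^sub>M gaussian_noise \<nu> N"
    using assms(1) by simp
  from measurable_compose[OF this measurable_residual_gaussian[OF assms(2)]]
  show ?thesis unfolding residual_observation by simp
qed

text \<open>Needed to integrate the union bound over the matrix term by term.\<close>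

lemma measurable_emeasure_residual:
  assumes "\<nu> > 0" "J \<subseteq> {..<M}" "B \<in> sets borel"
  shows "(\<lambda>A. emeasure (gaussian_noise \<nu> N)
            {n \<in> space (gaussian_noise \<nu> N). residual N J A (observation N M A x n) \<in> B})
     \<in> borel_measurable (gaussian_matrix N M)"
proof -
  interpret O: prob_space "gaussian_noise \<nu> N" by (rule prob_space_gaussian_noise) fact
  let ?P = "gaussian_matrix N M \<Otimes>\<^sub>M gaussian_noise \<nu> N"
  let ?r = "\<lambda>p. residual N J (fst p) (\<lambda>i. (\<Sum>j<M. fst p (i, j) * x j) + snd p i)"
  have "?r -` B \<inter> space ?P \<in> sets ?P"
    using measurable_residual_gaussian[OF assms(2)] assms(3)
    by (rule measurable_sets)
  then have "(\<lambda>A. emeasure (gaussian_noise \<nu> N) (Pair A -` (?r -` B \<inter> space ?P)))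
      \<in> borel_measurable (gaussian_matrix N M)"
    by (rule O.measurable_emeasure_Pair)
  then show ?thesis
    by (rule measurable_cong[THEN iffD1, rotated])
      (auto simp: residual_observation space_pair_measure intro!: arg_cong[of _ _ "emeasure _"])
qed

text \<open>Chernoff's bound for the lower tail: the indicator of a residual at most
  \<open>T\<close> is below \<open>exp (s * T)\<close> times \<open>exp (- s * residual)\<close>,
  whose mean is bounded by \<open>residual_laplace_bound\<close> with \<tau> =
  \<open>\<nu>\<^sup>2\<close>.\<close>

lemma wrong_support_bound:
  assumes "\<nu> > 0" "s \<ge> 0" "J \<subseteq> {..<M}" "card J + m \<le> N"
  shows "(\<integral>\<^sup>+A. emeasure (gaussian_noise \<nu> N)
            {n \<in> space (gaussian_noise \<nu> N). residual N J A (observation N M A x n) \<in> {..T}}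
          \<partial>gaussian_matrix N M)
     \<le> ennreal (exp (s * T) * (1 / (1 + s * ((\<Sum>j\<in>{..<M} - J. (cmod (x j))\<^sup>2) + \<nu>\<^sup>2))) ^ m)"
proof -
  let ?\<Omega> = "gaussian_noise \<nu> N" and ?GM = "gaussian_matrix N M"
  interpret O: prob_space ?\<Omega> by (rule prob_space_gaussian_noise) fact
  let ?r = "\<lambda>A n. residual N J A (\<lambda>i. (\<Sum>j<M. A (i, j) * x j) + n i)"
  have [measurable]: "(\<lambda>p. ?r (fst p) (snd p)) \<in> borel_measurable (?GM \<Otimes>\<^sub>M ?\<Omega>)"
    by (rule measurable_residual_gaussian[OF assms(3)])
  have m1: "(\<lambda>A. \<integral>\<^sup>+n. ennreal (exp (- s * ?r A n)) \<partial>?\<Omega>) \<in> borel_measurable ?GM"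
    by (intro O.borel_measurable_nn_integral) (simp add: case_prod_beta)
  have "emeasure ?\<Omega> {n \<in> space ?\<Omega>. residual N J A (observation N M A x n) \<in> {..T}}
     \<le> ennreal (exp (s * T)) * (\<integral>\<^sup>+n. ennreal (exp (- s * ?r A n)) \<partial>?\<Omega>)"
    if A: "A \<in> space ?GM" for A
  proof -
    have [measurable]: "?r A \<in> borel_measurable ?\<Omega>"
      using measurable_residual_noise[OF A assms(3)] unfolding residual_observation .
    have "emeasure ?\<Omega> {n \<in> space ?\<Omega>. residual N J A (observation N M A x n) \<in> {..T}}
       = (\<integral>\<^sup>+n. indicator {n \<in> space ?\<Omega>. ?r A n \<in> {..T}} n \<partial>?\<Omega>)"
      unfolding residual_observation by (subst nn_integral_indicator) auto
    also have "\<dots> \<le> (\<integral>\<^sup>+n. ennreal (exp (s * T)) * ennreal (exp (- s * ?r A n)) \<partial>?\<Omega>)"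
    proof (intro nn_integral_mono)
      fix n
      have "1 \<le> exp (s * T) * exp (- s * ?r A n)" if "?r A n \<le> T"
        using mult_left_mono[OF that assms(2)] by (simp flip: exp_add)
      then show "indicator {n \<in> space ?\<Omega>. ?r A n \<in> {..T}} n
          \<le> ennreal (exp (s * T)) * ennreal (exp (- s * ?r A n))"
        by (auto simp: indicator_def simp flip: ennreal_mult ennreal_1 intro!: ennreal_leI)
    qed
    also have "\<dots> = ennreal (exp (s * T)) * (\<integral>\<^sup>+n. ennreal (exp (- s * ?r A n)) \<partial>?\<Omega>)"
      by (rule nn_integral_cmult) simp
    finally show ?thesis .
  qed
  then have "(\<integral>\<^sup>+A. emeasure ?\<Omega> {n \<in> space ?\<Omega>. residual N J A (observation N M A x n) \<in> {..T}} \<partial>?GM)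
    \<le> (\<integral>\<^sup>+A. ennreal (exp (s * T)) * (\<integral>\<^sup>+n. ennreal (exp (- s * ?r A n)) \<partial>?\<Omega>) \<partial>?GM)"
    by (intro nn_integral_mono)
  also have "\<dots> = ennreal (exp (s * T)) * (\<integral>\<^sup>+A. (\<integral>\<^sup>+n. ennreal (exp (- s * ?r A n)) \<partial>?\<Omega>) \<partial>?GM)"
    by (rule nn_integral_cmult[OF m1])
  also have "\<dots> \<le> ennreal (exp (s * T)) *
      ennreal ((1 / (1 + s * ((\<Sum>j\<in>{..<M} - J. (cmod (x j))\<^sup>2) + \<nu>\<^sup>2))) ^ m)"
  proof (intro mult_left_mono residual_laplace_bound assms O.prob_space_axioms measurable_gaussian_noise)
    show "(LINT n|?\<Omega>. cis (Re (\<Sum>i<N. q i * n i))) = of_real (exp (- \<nu>\<^sup>2 / 4 * (\<Sum>i<N. (cmod (q i))\<^sup>2)))" for q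
      unfolding gaussian_noise_def by (rule gauss_vec_char) (use assms in auto)
  qed auto
  also have "\<dots> = ennreal (exp (s * T) * (1 / (1 + s * ((\<Sum>j\<in>{..<M} - J. (cmod (x j))\<^sup>2) + \<nu>\<^sup>2))) ^ m)"
    using assms(1,2) by (subst ennreal_mult) (auto intro!: add_nonneg_nonneg mult_nonneg_nonneg sum_nonneg divide_nonneg_nonneg zero_le_power)
  finally show ?thesis .
qed

text \<open>The noiseless Laplace bound for the unit vector at \<open>l\<close>, with
  \<open>m = 1\<close>: the probability of a vanishing residual is at most
  \<open>1 / (1 + s)\<close> for every \<open>s\<close>, hence zero.\<close>

lemma AE_gaussian_column_not_in_span:
  assumes "l < M" "J \<subseteq> {..<M}" "l \<notin> J" "card J < N"
  shows "AE A in gaussian_matrix N M. residual N J A (\<lambda>i. A (i, l)) > 0"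
proof -
  interpret GM: prob_space "gaussian_matrix N M" by (rule prob_space_gaussian_matrix)
  define x :: "nat \<Rightarrow> complex" where "x = (\<lambda>j. if j = l then 1 else 0)"
  \<comment> \<open>An auxiliary probability space; the random vector taken on it is identically
    zero.\<close>
  let ?\<Omega> = "gaussian_noise 1 N"
  interpret O: prob_space ?\<Omega> by (rule prob_space_gaussian_noise) simp
  have Ax: "(\<Sum>j<M. A (i, j) * x j) = A (i, l)" for A :: "nat \<times> nat \<Rightarrow> complex" and i
    using assms(1) unfolding x_def by (simp add: if_distrib[of "(*) _"] cong: if_cong)
  have "(\<Sum>j\<in>{..<M} - J. (cmod (x j))\<^sup>2) = (\<Sum>j\<in>{..<M} - J. if j = l then 1 else 0)"
    unfolding x_def by (intro sum.cong) auto
  then have x1: "(\<Sum>j\<in>{..<M} - J. (cmod (x j))\<^sup>2) = 1" using assms by simp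
  let ?r = "\<lambda>A. residual N J A (\<lambda>i. A (i, l))"
  have "(\<lambda>p. ?r (fst p)) \<in> borel_measurable (gaussian_matrix N M \<Otimes>\<^sub>M ?\<Omega>)"
    using measurable_residual_observation[where N = N and M = M and \<eta> = "\<lambda>_ _. 0" and x = x, OF _ assms(2)]
    unfolding Ax by simp
  note m0 = this
  obtain n where n: "n \<in> space ?\<Omega>" using O.not_empty by auto
  have "(\<lambda>A. (A, n)) \<in> gaussian_matrix N M \<rightarrow>\<^sub>M gaussian_matrix N M \<Otimes>\<^sub>M ?\<Omega>"
    using n by simp
  from measurable_compose[OF this m0]
  have m[measurable]: "?r \<in> borel_measurable (gaussian_matrix N M)" by simp
  have "GM.prob {A \<in> space (gaussian_matrix N M). ?r A \<le> 0} \<le> 1 / (1 + s)" if "s \<ge> 0" for s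
  proof -
    have "emeasure (gaussian_matrix N M) {A \<in> space (gaussian_matrix N M). ?r A \<le> 0}
       = (\<integral>\<^sup>+A. indicator {A \<in> space (gaussian_matrix N M). ?r A \<le> 0} A \<partial>gaussian_matrix N M)"
      by (subst nn_integral_indicator) auto
    also have "\<dots> \<le> (\<integral>\<^sup>+A. (\<integral>\<^sup>+w. ennreal (exp (- s * residual N J A (\<lambda>i. (\<Sum>j<M. A (i, j) * x j) + 0))) \<partial>?\<Omega>)
            \<partial>gaussian_matrix N M)"
    proof (intro nn_integral_mono)
      fix A
      have "1 \<le> exp (- s * ?r A)" if "?r A \<le> 0"
        using mult_left_mono[OF that \<open>s \<ge> 0\<close>] by simp
      then show "indicator {A \<in> space (gaussian_matrix N M). ?r A \<le> 0} A
        \<le> (\<integral>\<^sup>+w. ennreal (exp (- s * residual N J A (\<lambda>i. (\<Sum>j<M. A (i, j) * x j) + 0))) \<partial>?\<Omega>)"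
        unfolding Ax by (auto simp: indicator_def O.emeasure_space_1 ennreal_ge_1)
    qed
    also have "\<dots> \<le> ennreal ((1 / (1 + s * ((\<Sum>j\<in>{..<M} - J. (cmod (x j))\<^sup>2) + 0))) ^ 1)"
      using assms that by (intro residual_laplace_bound O.prob_space_axioms) (auto simp: O.prob_space)
    finally show ?thesis unfolding x1 using that by (simp add: GM.emeasure_eq_measure)
  qed
  note le = this
  have "GM.prob {A \<in> space (gaussian_matrix N M). ?r A \<le> 0} \<le> 0"
  proof (rule field_le_epsilon)
    fix e :: real assume "e > 0"
    then have "1 / (1 + 1 / e) \<le> 0 + e" by (simp add: field_simps)
    then show "GM.prob {A \<in> space (gaussian_matrix N M). ?r A \<le> 0} \<le> 0 + e"
      using le[of "1 / e"] \<open>e > 0\<close> by simp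
  qed
  then have "GM.prob {A \<in> space (gaussian_matrix N M). \<not> ?r A > 0} = 0"
    using measure_nonneg[of "gaussian_matrix N M"] by (simp add: not_less order_antisym)
  then show ?thesis
    by (subst AE_iff_measurable[OF _ refl]) (auto simp: GM.emeasure_eq_measure)
qed

text \<open>A dependence with \<open>z l\<close> nonzero puts column \<open>l\<close> into the span
  of the others, which is almost surely excluded for each of the finitely many
  \<open>l\<close>.\<close>

lemma AE_gaussian_independent_cols:
  assumes "I \<subseteq> {..<M}" "card I \<le> N"
  shows "AE A in gaussian_matrix N M. independent_cols N I (\<lambda>j i. A (i, j))"
proof -
  have fin: "finite I" using assms(1) by (rule finite_subset) simp
  have "AE A in gaussian_matrix N M. \<forall>l\<in>I. residual N (I - {l}) A (\<lambda>i. A (i, l)) > 0"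
  proof (intro AE_finite_allI fin AE_gaussian_column_not_in_span)
    fix l assume "l \<in> I"
    then show "card (I - {l}) < N" using card_gt_0_iff[of I] fin assms(2) by (auto simp: card_Diff_singleton)
  qed (use assms in auto)
  then show ?thesis
  proof (rule AE_mp, intro AE_I2 impI)
    fix A assume pos: "\<forall>l\<in>I. residual N (I - {l}) A (\<lambda>i. A (i, l)) > 0"
    show "independent_cols N I (\<lambda>j i. A (i, j))"
      unfolding independent_cols_def
    proof (intro allI impI ballI, rule ccontr)
      fix z l assume z: "\<forall>i<N. (\<Sum>j\<in>I. z j * A (i, j)) = 0" and l: "l \<in> I" "z l \<noteq> 0"
      have "A (i, l) - (\<Sum>j\<in>I - {l}. A (i, j) * (- z j / z l)) = 0" if "i < N" for i
      proof -
        have "z l * A (i, l) + (\<Sum>j\<in>I - {l}. z j * A (i, j)) = 0"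
          using z that sum.remove[OF fin l(1), of "\<lambda>j. z j * A (i, j)"] by simp
        moreover have "(\<Sum>j\<in>I - {l}. A (i, j) * (- z j / z l)) = - (\<Sum>j\<in>I - {l}. z j * A (i, j)) / z l"
          by (simp add: sum_divide_distrib sum_negf mult.commute)
        moreover from calculation(1) have "A (i, l) = - (\<Sum>j\<in>I - {l}. z j * A (i, j)) / z l"
          using l(2) by (subst eq_divide_eq) (simp add: eq_neg_iff_add_eq_0 mult.commute)
        ultimately show ?thesis by simp
      qed
      then have "sqnorm_n N (\<lambda>i. A (i, l) - (\<Sum>j\<in>I - {l}. A (i, j) * (- z j / z l))) = 0"
        unfolding sqnorm_n_eq_0 by blast
      then show False
        using residual_le[of N "I - {l}" A "\<lambda>i. A (i, l)" "\<lambda>j. - z j / z l"] pos l(1) by fastforce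
    qed
  qed
qed

text \<open>The signal lies in the span of the columns in \<open>I\<close>, so only the noise
  component along the complement remains, and Chernoff's bound uses its exponential moment. The
  estimate holds for each matrix with independent columns, without averaging.\<close>

lemma true_support_bound:
  assumes A: "A \<in> space (gaussian_matrix N M)" and ind: "independent_cols N I (\<lambda>j i. A (i, j))"
    and "\<nu> > 0" "s \<ge> 0" "s * \<nu>\<^sup>2 < 1" "I = vsupp M x" "card I + m = N"
  shows "emeasure (gaussian_noise \<nu> N)
            {n \<in> space (gaussian_noise \<nu> N). residual N I A (observation N M A x n) \<in> {T<..}}
     \<le> ennreal (exp (- s * T) * (1 / (1 - s * \<nu>\<^sup>2)) ^ m)"
proof -
  let ?\<Omega> = "gaussian_noise \<nu> N"
  interpret O: prob_space ?\<Omega> by (rule prob_space_gaussian_noise) fact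
  have I: "finite I" "I \<subseteq> {..<M}" using assms(6) by (auto simp: vsupp_def)
  obtain u where u: "orthonormal_n N m u" "\<forall>k<m. \<forall>j\<in>I. inner_n N (u k) (\<lambda>i. A (i, j)) = 0"
    using orthonormal_complement[OF I(1), of m N "\<lambda>j i. A (i, j)"] assms(7) by auto
  define W where "W = (\<lambda>k n. inner_n N (u k) n)"
  note measurable_gaussian_noise[measurable]
  have mW[measurable]: "W k \<in> borel_measurable ?\<Omega>" for k
    unfolding W_def inner_n_def by measurable
  have [measurable]: "(\<lambda>n. residual N I A (observation N M A x n)) \<in> borel_measurable ?\<Omega>"
    by (rule measurable_residual_noise[OF A I(2)])
  have res: "residual N I A (observation N M A x n) \<le> (\<Sum>k<m. (cmod (W k n))\<^sup>2)" for n
  proof -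
    obtain z where z: "sqnorm_n N (\<lambda>i. n i + (\<Sum>j\<in>I. z j * A (i, j))) = (\<Sum>k<m. (cmod (W k n))\<^sup>2)"
      using residual_attained[OF I(1) assms(7) ind u, of n] unfolding W_def by auto
    have "(\<Sum>j<M. A (i, j) * x j) = (\<Sum>j\<in>I. A (i, j) * x j)" for i
      using I by (intro sum.mono_neutral_right) (auto simp: assms(6) vsupp_def)
    \<comment> \<open>The signal is absorbed into the fit by taking the coefficients
      \<open>x j - z j\<close>.\<close>
    then have "(\<lambda>i. (\<Sum>j<M. A (i, j) * x j) + n i - (\<Sum>j\<in>I. A (i, j) * (x j - z j)))
        = (\<lambda>i. n i + (\<Sum>j\<in>I. z j * A (i, j)))"
      by (simp add: algebra_simps sum_subtractf)
    then show ?thesis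
      using residual_le[of N I A "\<lambda>i. (\<Sum>j<M. A (i, j) * x j) + n i" "\<lambda>j. x j - z j"] z
      unfolding residual_observation by simp
  qed
  have mgf: "(\<integral>\<^sup>+n. ennreal (exp (Re (\<Sum>k<m. p k * W k n))) \<partial>?\<Omega>)
        = ennreal (exp (\<nu>\<^sup>2 / 4 * (\<Sum>k<m. (cmod (p k))\<^sup>2)))" for p
  proof -
    obtain q where q: "\<And>v. (\<Sum>k<m. p k * inner_n N (u k) v) = (\<Sum>i<N. q i * v i)"
        "(\<Sum>i<N. (cmod (q i))\<^sup>2) = (\<Sum>k<m. (cmod (p k))\<^sup>2)"
      using orthonormal_linear_form[OF u(1), of p] by blast
    show ?thesis
      unfolding W_def q(1) q(2)[symmetric] gaussian_noise_def
      by (rule gauss_vec_mgf) (use assms in auto)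
  qed
  have "emeasure ?\<Omega> {n \<in> space ?\<Omega>. residual N I A (observation N M A x n) \<in> {T<..}}
     = (\<integral>\<^sup>+n. indicator {n \<in> space ?\<Omega>. residual N I A (observation N M A x n) \<in> {T<..}} n \<partial>?\<Omega>)"
    by (subst nn_integral_indicator) auto
  also have "\<dots> \<le> (\<integral>\<^sup>+n. ennreal (exp (- s * T)) * ennreal (exp (s * (\<Sum>k<m. (cmod (W k n))\<^sup>2))) \<partial>?\<Omega>)"
  proof (intro nn_integral_mono)
    fix n
    have "1 \<le> exp (- s * T) * exp (s * (\<Sum>k<m. (cmod (W k n))\<^sup>2))" if "residual N I A (observation N M A x n) > T"
      using mult_left_mono[of T "\<Sum>k<m. (cmod (W k n))\<^sup>2" s] res[of n] that assms(4) by (simp flip: exp_add)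
    then show "indicator {n \<in> space ?\<Omega>. residual N I A (observation N M A x n) \<in> {T<..}} n
        \<le> ennreal (exp (- s * T)) * ennreal (exp (s * (\<Sum>k<m. (cmod (W k n))\<^sup>2)))"
      by (auto simp: indicator_def simp flip: ennreal_mult ennreal_1 intro!: ennreal_leI)
  qed
  also have "\<dots> = ennreal (exp (- s * T)) * ennreal ((1 / (1 - s * \<nu>\<^sup>2)) ^ m)"
    using exp_moment_sum_squares[OF O.prob_space_axioms mW mgf assms(4,5)]
    by (subst nn_integral_cmult) auto
  also have "\<dots> = ennreal (exp (- s * T) * (1 / (1 - s * \<nu>\<^sup>2)) ^ m)"
    using assms(5) by (subst ennreal_mult) auto
  finally show ?thesis .
qed

section \<open>Error probability\<close>

text \<open>A function that is not integrable has integral 0 by convention, so the bound transfers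
  in either case and applies to \<open>p_err_fixed\<close> as it stands.\<close>

lemma integral_le_of_nn_integral_le:
  fixes f :: "'a \<Rightarrow> real"
  assumes "\<And>w. 0 \<le> f w" "(\<integral>\<^sup>+w. ennreal (f w) \<partial>M) \<le> ennreal c" "0 \<le> c"
  shows "(LINT w|M. f w) \<le> c"
proof (cases "integrable M f")
  case True
  have "(\<integral>\<^sup>+w. ennreal (f w) \<partial>M) = ennreal (LINT w|M. f w)"
    by (rule nn_integral_eq_integral[OF True]) (rule AE_I2, rule assms(1))
  with assms(2) have "ennreal (LINT w|M. f w) \<le> ennreal c" by (simp only:)
  with assms(3) show ?thesis by (simp only: ennreal_le_iff)
next
  case False
  then show ?thesis using assms(3) by (simp add: not_integrable_integral_eq)
qed

text \<open>On an error the selected wrong support has residual at most that of the true one. So for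
  any threshold \<open>T\<close> either the true residual exceeds \<open>T\<close> or a wrong one is
  at most \<open>T\<close>; the union bound does the rest.\<close>

lemma p_err_fixed_min_residual_le:
  assumes A: "A \<in> space (gaussian_matrix N M)" and "\<nu> > 0" "L \<le> M" "l0norm M x = L"
  shows "ennreal (p_err_fixed \<nu> N M (min_residual_decoder N M L) x A)
    \<le> emeasure (gaussian_noise \<nu> N)
         {n \<in> space (gaussian_noise \<nu> N). residual N (vsupp M x) A (observation N M A x n) \<in> {T<..}}
      + (\<Sum>J\<in>L_subsets M L - {vsupp M x}. emeasure (gaussian_noise \<nu> N)
         {n \<in> space (gaussian_noise \<nu> N). residual N J A (observation N M A x n) \<in> {..T}})"
proof -
  let ?\<Omega> = "gaussian_noise \<nu> N" and ?S = "L_subsets M L - {vsupp M x}"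
  interpret O: prob_space ?\<Omega> by (rule prob_space_gaussian_noise) fact
  define hi where "hi = {n \<in> space ?\<Omega>. residual N (vsupp M x) A (observation N M A x n) \<in> {T<..}}"
  define lo where "lo = (\<lambda>J. {n \<in> space ?\<Omega>. residual N J A (observation N M A x n) \<in> {..T}})"
  have I: "vsupp M x \<in> L_subsets M L" "vsupp M x \<subseteq> {..<M}"
    using assms(4) by (auto simp: L_subsets_def l0norm_def vsupp_def)
  have res[measurable]: "(\<lambda>n. residual N J A (observation N M A x n)) \<in> borel_measurable ?\<Omega>"
    if "J \<subseteq> {..<M}" for J
    by (rule measurable_residual_noise[OF A that])
  have m1: "hi \<in> sets ?\<Omega>" unfolding hi_def using I(2) by measurable
  have m2: "lo J \<in> sets ?\<Omega>" if "J \<in> ?S" for J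
  proof -
    have [measurable]: "(\<lambda>n. residual N J A (observation N M A x n)) \<in> borel_measurable ?\<Omega>"
      using that by (intro res) (simp add: L_subsets_def)
    show ?thesis unfolding lo_def by measurable
  qed
  have fin: "finite ?S" by (simp add: finite_L_subsets)
  have m3: "(\<Union>J\<in>?S. lo J) \<in> sets ?\<Omega>" by (rule sets.finite_UN[OF fin m2])
  have "{n \<in> space ?\<Omega>. vsupp M (min_residual_decoder N M L A (observation N M A x n)) \<noteq> vsupp M x}
      \<subseteq> hi \<union> (\<Union>J\<in>?S. lo J)"
  proof
    fix n assume n: "n \<in> {n \<in> space ?\<Omega>. vsupp M (min_residual_decoder N M L A (observation N M A x n)) \<noteq> vsupp M x}"
    let ?y = "observation N M A x n"
    let ?J = "min_residual_support N M L A ?y"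
    have "?J \<in> ?S" using n min_residual_support(1)[OF assms(3)] vsupp_min_residual_decoder[OF assms(3)] by auto
    moreover have "residual N ?J A ?y \<le> residual N (vsupp M x) A ?y"
      using min_residual_support(2)[OF assms(3) I(1)] .
    moreover from this have "n \<in> hi \<or> n \<in> lo ?J"
      using n by (auto simp: hi_def lo_def)
    ultimately show "n \<in> hi \<union> (\<Union>J\<in>?S. lo J)" by blast
  qed
  then have "p_err_fixed \<nu> N M (min_residual_decoder N M L) x A \<le> measure ?\<Omega> (hi \<union> (\<Union>J\<in>?S. lo J))"
    unfolding p_err_fixed_def by (intro O.finite_measure_mono sets.Un m1 m3)
  also have "\<dots> \<le> measure ?\<Omega> hi + measure ?\<Omega> (\<Union>J\<in>?S. lo J)"
    by (rule measure_Un_le[OF m1 m3])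
  also have "\<dots> \<le> measure ?\<Omega> hi + (\<Sum>J\<in>?S. measure ?\<Omega> (lo J))"
    using m2 by (intro add_left_mono O.finite_measure_subadditive_finite[OF fin]) blast
  finally have "ennreal (p_err_fixed \<nu> N M (min_residual_decoder N M L) x A)
      \<le> ennreal (measure ?\<Omega> hi + (\<Sum>J\<in>?S. measure ?\<Omega> (lo J)))"
    by (rule ennreal_leI)
  also have "\<dots> = emeasure ?\<Omega> hi + (\<Sum>J\<in>?S. emeasure ?\<Omega> (lo J))"
    unfolding O.emeasure_eq_measure
    by (subst sum_ennreal) (simp_all add: sum_nonneg ennreal_plus[symmetric] del: ennreal_plus)
  finally show ?thesis unfolding hi_def lo_def .
qed

text \<open>Averages the union bound over the matrix. The Chernoff parameter \<open>t J\<close> may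
  vary with the support, since the best choice depends on how many indices \<open>J\<close>
  misses.\<close>

lemma p_err_min_residual_le:
  assumes "\<nu> > 0" "L \<le> M" "l0norm M x = L" "N = L + m"
    and "0 \<le> s" "s * \<nu>\<^sup>2 < 1" and t: "\<And>J. 0 \<le> t J"
  shows "p_err \<nu> N M (min_residual_decoder N M L) x
    \<le> exp (- s * T) * (1 / (1 - s * \<nu>\<^sup>2)) ^ m
      + (\<Sum>J\<in>L_subsets M L - {vsupp M x}.
          exp (t J * T) * (1 / (1 + t J * ((\<Sum>j\<in>{..<M} - J. (cmod (x j))\<^sup>2) + \<nu>\<^sup>2))) ^ m)"
proof -
  let ?\<Omega> = "gaussian_noise \<nu> N" and ?S = "L_subsets M L - {vsupp M x}" and ?GM = "gaussian_matrix N M"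
  interpret O: prob_space ?\<Omega> by (rule prob_space_gaussian_noise) fact
  interpret GM: prob_space ?GM by (rule prob_space_gaussian_matrix)
  let ?hi = "\<lambda>A. emeasure ?\<Omega> {n \<in> space ?\<Omega>. residual N (vsupp M x) A (observation N M A x n) \<in> {T<..}}"
  let ?lo = "\<lambda>J A. emeasure ?\<Omega> {n \<in> space ?\<Omega>. residual N J A (observation N M A x n) \<in> {..T}}"
  define h where "h = exp (- s * T) * (1 / (1 - s * \<nu>\<^sup>2)) ^ m"
  define l where "l = (\<lambda>J. exp (t J * T) * (1 / (1 + t J * ((\<Sum>j\<in>{..<M} - J. (cmod (x j))\<^sup>2) + \<nu>\<^sup>2))) ^ m)"
  have h0: "0 \<le> h" using assms(6) by (simp add: h_def)
  have l0: "0 \<le> l J" for J unfolding l_def using t[of J] assms(1)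
    by (intro mult_nonneg_nonneg zero_le_power divide_nonneg_nonneg add_nonneg_nonneg sum_nonneg) auto
  have I: "vsupp M x \<subseteq> {..<M}" "card (vsupp M x) = L" "card (vsupp M x) + m = N"
    using assms(3,4) by (auto simp: l0norm_def vsupp_def)
  have S: "J \<subseteq> {..<M}" "card J + m \<le> N" if "J \<in> ?S" for J
    using that assms(4) by (auto simp: L_subsets_def)
  have mhi[measurable]: "?hi \<in> borel_measurable ?GM"
    using assms(1) I by (intro measurable_emeasure_residual) auto
  have mlo[measurable]: "?lo J \<in> borel_measurable ?GM" if "J \<in> ?S" for J
    using assms(1) S[OF that] by (intro measurable_emeasure_residual) auto
  have "(\<integral>\<^sup>+A. ennreal (p_err_fixed \<nu> N M (min_residual_decoder N M L) x A) \<partial>?GM)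
     \<le> (\<integral>\<^sup>+A. ?hi A + (\<Sum>J\<in>?S. ?lo J A) \<partial>?GM)"
    by (intro nn_integral_mono p_err_fixed_min_residual_le assms)
  also have "\<dots> = (\<integral>\<^sup>+A. ?hi A \<partial>?GM) + (\<Sum>J\<in>?S. (\<integral>\<^sup>+A. ?lo J A \<partial>?GM))"
    by (subst nn_integral_add[OF mhi borel_measurable_sum[OF mlo]], assumption, subst nn_integral_sum[OF mlo])
      (assumption, rule refl)
  also have "\<dots> \<le> ennreal h + (\<Sum>J\<in>?S. ennreal (l J))"
  proof (intro add_mono sum_mono)
    have "AE A in ?GM. independent_cols N (vsupp M x) (\<lambda>j i. A (i, j))"
      using I by (intro AE_gaussian_independent_cols) auto
    then have "AE A in ?GM. ?hi A \<le> ennreal h"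
    proof (rule AE_mp, intro AE_I2 impI)
      fix A assume "A \<in> space ?GM" "independent_cols N (vsupp M x) (\<lambda>j i. A (i, j))"
      then show "?hi A \<le> ennreal h"
        unfolding h_def by (rule true_support_bound) (fact assms I refl)+
    qed
    then have "(\<integral>\<^sup>+A. ?hi A \<partial>?GM) \<le> (\<integral>\<^sup>+A. ennreal h \<partial>?GM)"
      by (rule nn_integral_mono_AE)
    then show "(\<integral>\<^sup>+A. ?hi A \<partial>?GM) \<le> ennreal h" by (simp add: GM.emeasure_space_1)
    show "(\<integral>\<^sup>+A. ?lo J A \<partial>?GM) \<le> ennreal (l J)" if "J \<in> ?S" for J
      unfolding l_def using S[OF that] t assms(1) by (intro wrong_support_bound) auto
  qed
  also have "\<dots> = ennreal (h + (\<Sum>J\<in>?S. l J))"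
    using h0 l0 by (simp add: sum_ennreal sum_nonneg)
  finally show ?thesis
    unfolding p_err_def h_def[symmetric] l_def[symmetric]
    using h0 l0 by (intro integral_le_of_nn_integral_le) (auto simp: p_err_fixed_def intro!: add_nonneg_nonneg sum_nonneg)
qed

section \<open>Explicit exponents and the union over supports\<close>

lemma one_divide_exp: "1 / exp y = exp (- y)" for y :: real
  by (simp add: exp_minus divide_inverse)

text \<open>With \<open>y = a / 8\<close>, the bound
  \<open>ln (1 - y) \<ge> - y - 2 * y\<^sup>2\<close> leaves, per degree of freedom, a^2/32 - a^2/16
  = -a^2/32.\<close>

lemma chi_square_upper_exponent:
  fixes a :: real
  assumes "0 \<le> a" "a \<le> 1"
  shows "exp (- (a / 8) * (m * (1 + a / 2))) * (1 / (1 - a / 8)) ^ m \<le> exp (- (m * a\<^sup>2 / 32))"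
proof -
  have "- (a / 8) - 2 * (a / 8)\<^sup>2 \<le> ln (1 - a / 8)"
    using assms by (intro ln_one_minus_pos_lower_bound) auto
  then have "exp (- (a / 8) - 2 * (a / 8)\<^sup>2) \<le> 1 - a / 8"
    using assms by (subst (asm) ln_ge_iff) auto
  then have "1 / (1 - a / 8) \<le> 1 / exp (- (a / 8) - 2 * (a / 8)\<^sup>2)"
    using assms by (intro divide_left_mono) (auto intro!: mult_pos_pos)
  also have "\<dots> = exp (a / 8 + 2 * (a / 8)\<^sup>2)" by (simp only: one_divide_exp) simp
  finally have "(1 / (1 - a / 8)) ^ m \<le> exp (a / 8 + 2 * (a / 8)\<^sup>2) ^ m"
    using assms by (intro power_mono) auto
  then have "exp (- (a / 8) * (m * (1 + a / 2))) * (1 / (1 - a / 8)) ^ m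
     \<le> exp (- (a / 8) * (m * (1 + a / 2))) * exp (m * (a / 8 + 2 * (a / 8)\<^sup>2))"
    by (simp add: exp_of_nat_mult)
  also have "\<dots> = exp (- (m * a\<^sup>2 / 32))"
    by (simp add: power2_eq_square algebra_simps flip: exp_add)
  finally show ?thesis .
qed

text \<open>Here \<open>c\<close> may be lowered to \<open>b\<close> and \<open>a\<close> raised to
  \<open>b\<close>. Then \<open>ln (1 + x) \<ge> x - x\<^sup>2\<close> with
  \<open>x \<le> b / 8\<close> leaves, per degree of freedom, b^2/64 - b^2/32 = -b^2/64.\<close>

lemma chi_square_lower_exponent:
  fixes a b c :: real
  assumes "0 \<le> a" "a \<le> b" "b \<le> 1" "b \<le> c"
  shows "exp (b / 16 * (m * (1 + a / 2))) * (1 / (1 + b / 16 * (1 + c))) ^ m \<le> exp (- (m * b\<^sup>2 / 64))"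
proof -
  let ?x = "b / 16 * (1 + b)"
  have b: "0 \<le> b" using assms by simp
  have x: "0 \<le> ?x" "?x \<le> b / 8" using assms b mult_left_mono[of "1 + b" 2 "b / 16"] by auto
  have "?x - ?x\<^sup>2 \<le> ln (1 + ?x)"
    using x assms(3) by (intro ln_one_plus_pos_lower_bound) auto
  then have "exp (?x - ?x\<^sup>2) \<le> 1 + ?x"
    using x by (subst (asm) ln_ge_iff) auto
  also have "\<dots> \<le> 1 + b / 16 * (1 + c)"
    using assms b by (intro add_left_mono mult_left_mono) auto
  finally have "1 / (1 + b / 16 * (1 + c)) \<le> 1 / exp (?x - ?x\<^sup>2)"
    using x by (intro divide_left_mono) (auto intro!: mult_pos_pos intro: less_le_trans[OF exp_gt_zero])
  also have "\<dots> = exp (?x\<^sup>2 - ?x)" by (simp only: one_divide_exp) simp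
  also have "\<dots> \<le> exp ((b / 8)\<^sup>2 - ?x)" using x by (simp add: power_mono)
  finally have "(1 / (1 + b / 16 * (1 + c))) ^ m \<le> exp ((b / 8)\<^sup>2 - ?x) ^ m"
    using assms b by (intro power_mono) auto
  then have "exp (b / 16 * (m * (1 + a / 2))) * (1 / (1 + b / 16 * (1 + c))) ^ m
     \<le> exp (b / 16 * (m * (1 + a / 2))) * exp (m * ((b / 8)\<^sup>2 - ?x))"
    by (simp add: exp_of_nat_mult)
  also have "\<dots> \<le> exp (b / 16 * (m * (1 + b / 2))) * exp (m * ((b / 8)\<^sup>2 - ?x))"
    using assms b by (intro mult_right_mono) (auto intro!: mult_left_mono)
  also have "\<dots> = exp (- (m * b\<^sup>2 / 64))"
    by (simp add: power2_eq_square algebra_simps flip: exp_add)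
  finally show ?thesis .
qed

lemma sum_Pow_power_card:
  fixes r :: "'a :: comm_semiring_1"
  assumes "finite S"
  shows "(\<Sum>D\<in>Pow S. r ^ card D) = (1 + r) ^ card S"
  using prod_add[OF assms, of "\<lambda>_. r" "\<lambda>_. 1"] by (simp add: add.commute)

text \<open>A support is determined by its symmetric difference with \<open>I\<close>, which is
  nonempty when it differs from \<open>I\<close>; the sum is thus dominated by that over all
  nonempty subsets of \<open>{..<M}\<close>.\<close>

lemma sum_wrong_supports_le:
  fixes r :: real
  assumes "r \<ge> 0" "I \<subseteq> {..<M}"
  shows "(\<Sum>J\<in>L_subsets M L - {I}. r ^ card ((I - J) \<union> (J - I))) \<le> (1 + r) ^ M - 1"
proof -
  let ?d = "\<lambda>J. (I - J) \<union> (J - I)"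
  have inj: "inj_on ?d X" for X by (rule inj_onI) blast
  have "(\<Sum>J\<in>L_subsets M L - {I}. r ^ card (?d J)) = (\<Sum>D\<in>?d ` (L_subsets M L - {I}). r ^ card D)"
    by (subst sum.reindex[OF inj]) simp
  also have "\<dots> \<le> (\<Sum>D\<in>Pow {..<M} - {{}}. r ^ card D)"
    using assms by (intro sum_mono2) (auto simp: L_subsets_def)
  also have "\<dots> = (1 + r) ^ M - 1"
    by (subst sum_diff1) (auto simp: sum_Pow_power_card)
  finally show ?thesis .
qed

lemma p_err_min_residual_explicit:
  fixes m :: nat and a :: real
  assumes "\<nu> > 0" "L \<le> M" "l0norm M x = L" "N = L + m"
    and a: "0 \<le> a" "a \<le> 1" "\<And>i. i \<in> vsupp M x \<Longrightarrow> a * \<nu>\<^sup>2 \<le> (cmod (x i))\<^sup>2"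
  shows "p_err \<nu> N M (min_residual_decoder N M L) x
    \<le> exp (- (m * a\<^sup>2 / 32)) + 2 ^ M * exp (- (m / 64)) + ((1 + exp (- (m * a\<^sup>2 / 128))) ^ M - 1)"
proof -
  define I where "I = vsupp M x"
  define r where "r = exp (- (m * a\<^sup>2 / 128))"
  let ?S = "L_subsets M L - {I}"
  define T where "T = \<nu>\<^sup>2 * (m * (1 + a / 2))"
  \<comment> \<open>The signal-to-noise gain of missing \<open>card (I - J)\<close> indices, capped
    at 1 to stay within the range of the logarithm bounds.\<close>
  define b where "b = (\<lambda>J. min 1 (card (I - J) * a))"
  define e where "e = (\<lambda>J. \<Sum>j\<in>{..<M} - J. (cmod (x j))\<^sup>2)"
  have I: "I \<subseteq> {..<M}" "card I = L" "finite I"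
    using assms(3) by (auto simp: I_def vsupp_def l0norm_def)
  have b0: "0 \<le> b J" for J using a by (simp add: b_def)
  have "p_err \<nu> N M (min_residual_decoder N M L) x
    \<le> exp (- (a / 8 / \<nu>\<^sup>2) * T) * (1 / (1 - (a / 8 / \<nu>\<^sup>2) * \<nu>\<^sup>2)) ^ m
      + (\<Sum>J\<in>?S. exp (b J / 16 / \<nu>\<^sup>2 * T) * (1 / (1 + b J / 16 / \<nu>\<^sup>2 * (e J + \<nu>\<^sup>2))) ^ m)"
    unfolding e_def I_def using assms b0 by (intro p_err_min_residual_le) auto
  also have "exp (- (a / 8 / \<nu>\<^sup>2) * T) * (1 / (1 - (a / 8 / \<nu>\<^sup>2) * \<nu>\<^sup>2)) ^ m
     = exp (- (a / 8) * (m * (1 + a / 2))) * (1 / (1 - a / 8)) ^ m"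
    using assms(1) by (simp add: T_def)
  also have "\<dots> \<le> exp (- (m * a\<^sup>2 / 32))" by (rule chi_square_upper_exponent[OF a(1,2)])
  \<comment> \<open>Each term is bounded by the sum of the capped and the uncapped estimate, so the
    index set need not be split.\<close>
  also have "(\<Sum>J\<in>?S. exp (b J / 16 / \<nu>\<^sup>2 * T) * (1 / (1 + b J / 16 / \<nu>\<^sup>2 * (e J + \<nu>\<^sup>2))) ^ m)
     \<le> (\<Sum>J\<in>?S. exp (- (m / 64)) + r ^ card ((I - J) \<union> (J - I)))"
  proof (rule sum_mono)
    fix J assume J: "J \<in> ?S"
    then have J': "finite J" "card J = L" "J \<subseteq> {..<M}" "J \<noteq> I" by (auto simp: L_subsets_def intro: finite_subset)
    define k where "k = card (I - J)"
    have k2: "card (J - I) = k"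
      using card_Diff_subset_Int[of J I] card_Diff_subset_Int[of I J] I J' by (simp add: k_def Int_commute)
    have d: "card ((I - J) \<union> (J - I)) = 2 * k"
      using I J' k2 by (subst card_Un_disjoint) (auto simp: k_def)
    have "k \<noteq> 0"
    proof
      assume "k = 0"
      then have "I \<subseteq> J" using I by (simp add: k_def)
      then show False using card_subset_eq[of J I] J' I by auto
    qed
    then have ab: "a \<le> b J" using a mult_right_mono[of 1 "real k" a] by (auto simp: b_def k_def[symmetric])
    have "k * (a * \<nu>\<^sup>2) = (\<Sum>j\<in>I - J. a * \<nu>\<^sup>2)" by (simp add: k_def)
    also have "\<dots> \<le> (\<Sum>j\<in>I - J. (cmod (x j))\<^sup>2)" using a(3) by (intro sum_mono) (auto simp: I_def)
    also have "\<dots> \<le> e J" unfolding e_def using I by (intro sum_mono2) auto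
    finally have "k * a \<le> e J / \<nu>\<^sup>2" using assms(1) by (simp add: field_simps)
    then have "b J \<le> e J / \<nu>\<^sup>2" by (simp add: b_def k_def[symmetric])
    then have main: "exp (b J / 16 * (m * (1 + a / 2))) * (1 / (1 + b J / 16 * (1 + e J / \<nu>\<^sup>2))) ^ m
       \<le> exp (- (m * (b J)\<^sup>2 / 64))"
      using a ab by (intro chi_square_lower_exponent) (auto simp: b_def)
    have eq1: "b J / 16 / \<nu>\<^sup>2 * (e J + \<nu>\<^sup>2) = b J / 16 * (1 + e J / \<nu>\<^sup>2)"
      using assms(1) by (simp add: field_simps)
    have eq2: "b J / 16 / \<nu>\<^sup>2 * T = b J / 16 * (m * (1 + a / 2))"
      using assms(1) by (simp add: T_def)
    have "exp (- (m * (b J)\<^sup>2 / 64)) \<le> exp (- (m / 64)) + r ^ (2 * k)"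
    proof (cases "k * a \<ge> 1")
      case True
      then have "b J = 1" by (simp add: b_def k_def[symmetric])
      then show ?thesis by (simp add: r_def)
    next
      case False
      then have "b J = k * a" by (simp add: b_def k_def[symmetric])
      \<comment> \<open>This makes the exponent linear in \<open>k\<close>, as a geometric weight
        \<open>r ^ (2 * k)\<close> requires; the halved rate 1/128 in \<open>r\<close> accounts for
        the size \<open>2 * k\<close> of the symmetric difference.\<close>
      have "real k \<le> (real k)\<^sup>2" using \<open>k \<noteq> 0\<close> by (simp add: power2_eq_square)
      from mult_right_mono[OF this, of "a\<^sup>2"] \<open>b J = k * a\<close>
      have "k * a\<^sup>2 \<le> (b J)\<^sup>2" by (simp add: power_mult_distrib)
      then have "m * (k * a\<^sup>2) \<le> m * (b J)\<^sup>2" by (intro mult_left_mono) auto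
      then have "exp (- (m * (b J)\<^sup>2 / 64)) \<le> exp ((2 * k) * (- (m * a\<^sup>2 / 128)))"
        by (simp add: algebra_simps)
      also have "\<dots> = r ^ (2 * k)" unfolding r_def by (subst exp_of_nat_mult[symmetric]) simp
      finally show ?thesis by (simp add: add_increasing)
    qed
    with main show "exp (b J / 16 / \<nu>\<^sup>2 * T) * (1 / (1 + b J / 16 / \<nu>\<^sup>2 * (e J + \<nu>\<^sup>2))) ^ m
        \<le> exp (- (m / 64)) + r ^ card ((I - J) \<union> (J - I))"
      unfolding d eq1 eq2 by (rule order_trans)
  qed
  also have "\<dots> = card ?S * exp (- (m / 64)) + (\<Sum>J\<in>?S. r ^ card ((I - J) \<union> (J - I)))"
    by (simp add: sum.distrib)
  also have "\<dots> \<le> 2 ^ M * exp (- (m / 64)) + ((1 + r) ^ M - 1)"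
  proof (intro add_mono mult_right_mono sum_wrong_supports_le I)
    have "card ?S \<le> card (Pow {..<M})" by (intro card_mono) (auto simp: L_subsets_def)
    then have "card ?S \<le> 2 ^ M" by (simp add: card_Pow)
    from of_nat_mono[OF this, where ?'a = real] show "real (card ?S) \<le> 2 ^ M" by simp
  qed (auto simp: r_def)
  finally show ?thesis by (simp add: r_def add_ac)
qed

section \<open>Growth of the sparsity and passage to the limit\<close>

lemma sparsity_le:
  assumes "\<beta> > 2" shows "sparsity \<beta> M \<le> M"
proof -
  have "(1 / \<beta>) * real M \<le> real M"
    using assms mult_right_mono[of "1 / \<beta>" 1 "real M"] by simp
  then show ?thesis unfolding sparsity_def by linarith
qed

lemma filterlim_sparsity:
  assumes "\<beta> > 2"
  shows "filterlim (\<lambda>M. real (sparsity \<beta> M)) at_top sequentially"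
proof (rule filterlim_at_top_mono)
  show "filterlim (\<lambda>M. (1 / \<beta>) * real M - 1) at_top sequentially"
    using assms by real_asymp
  show "\<forall>\<^sub>F M in sequentially. (1 / \<beta>) * real M - 1 \<le> real (sparsity \<beta> M)"
    unfolding sparsity_def by (intro always_eventually allI) linarith
qed

text \<open>The decoder is quantified before \<open>x\<close>: chosen afterwards, it could ignore
  the observation and return \<open>x M\<close> itself. Limits are taken in \<open>M\<close>, along
  which the sparsity tends to infinity.\<close>

theorem mainTheorem1:
  "\<exists>C1 :: real \<Rightarrow> (nat \<Rightarrow> real) \<Rightarrow> real \<Rightarrow> real.
     (\<forall>\<beta> \<mu> \<nu>. C1 \<beta> \<mu> \<nu> > 1) \<and>
     (\<forall>(\<beta>::real) (\<nu>::real) (N :: nat \<Rightarrow> nat). \<beta> > 2 \<longrightarrow> \<nu> > 0 \<longrightarrow>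
        (\<exists>D. (\<forall>M. sparse_decoder (N M) M (sparsity \<beta> M) (D M)) \<and>
             (\<forall>x :: nat \<Rightarrow> nat \<Rightarrow> complex.
                (\<forall>M. l0norm M (x M) = sparsity \<beta> M) \<longrightarrow>
                filterlim (\<lambda>M. real (sparsity \<beta> M) * min_mag M (x M) ^ 4 / ln (real (sparsity \<beta> M)))
                  at_top sequentially \<longrightarrow>
                (\<lambda>M. real (N M)) \<succ> (\<lambda>M. C1 \<beta> (\<lambda>M. min_mag M (x M)) \<nu> * real (sparsity \<beta> M)) \<longrightarrow>
                reliable_recovery \<nu> N D x)))"
\<comment> \<open>This constant gives \<open>m = N - L \<ge> 128 * \<beta> * L\<close>, and
  eventually \<open>M \<le> 2 * \<beta> * L\<close>, so that \<open>m \<ge> 64 * M\<close>. The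
  absolute value keeps it above 1 for every real \<beta>.\<close>
proof (rule exI[of _ "\<lambda>\<beta> _ _. 2 + 128 * \<bar>\<beta>\<bar>"], intro conjI allI impI)
  show "1 < 2 + 128 * \<bar>\<beta>\<bar>" for \<beta> :: real by simp
next
  fix \<beta> \<nu> :: real and N :: "nat \<Rightarrow> nat"
  assume \<beta>: "\<beta> > 2" and \<nu>: "\<nu> > 0"
  let ?L = "sparsity \<beta>"
  define D where "D = (\<lambda>M. min_residual_decoder (N M) M (?L M))"
  show "\<exists>D. (\<forall>M. sparse_decoder (N M) M (sparsity \<beta> M) (D M)) \<and>
             (\<forall>x :: nat \<Rightarrow> nat \<Rightarrow> complex.
                (\<forall>M. l0norm M (x M) = sparsity \<beta> M) \<longrightarrow>
                filterlim (\<lambda>M. real (sparsity \<beta> M) * min_mag M (x M) ^ 4 / ln (real (sparsity \<beta> M)))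
                  at_top sequentially \<longrightarrow>
                (\<lambda>M. real (N M)) \<succ> (\<lambda>M. (2 + 128 * \<bar>\<beta>\<bar>) * real (sparsity \<beta> M)) \<longrightarrow>
                reliable_recovery \<nu> N D x)"
  proof (rule exI[of _ D], intro conjI allI impI)
    show "sparse_decoder (N M) M (?L M) (D M)" for M
      unfolding D_def by (rule sparse_decoder_min_residual[OF sparsity_le[OF \<beta>]])
  next
    fix x :: "nat \<Rightarrow> nat \<Rightarrow> complex"
    assume l0: "\<forall>M. l0norm M (x M) = ?L M"
      and snr: "filterlim (\<lambda>M. real (?L M) * min_mag M (x M) ^ 4 / ln (real (?L M))) at_top sequentially"
      and N: "(\<lambda>M. real (N M)) \<succ> (\<lambda>M. (2 + 128 * \<bar>\<beta>\<bar>) * real (?L M))"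
    define a where "a = (\<lambda>M. min 1 ((min_mag M (x M))\<^sup>2 / \<nu>\<^sup>2))"
    have Linf: "filterlim (\<lambda>M. real (?L M)) at_top sequentially"
      by (rule filterlim_sparsity[OF \<beta>])
    have large: "\<forall>\<^sub>F M in sequentially. c \<le> real (?L M)" for c
      using Linf by (simp add: filterlim_at_top)
    have Nlarge: "\<forall>\<^sub>F M in sequentially. (2 + 128 * \<beta>) * real (?L M) < real (N M)"
    proof -
      \<comment> \<open>The degenerate alternative of \<open>\<succ>\<close> is ruled out because
        the sparsity is eventually positive.\<close>
      have "\<not> (\<forall>M. real (N M) = 0 \<and> (2 + 128 * \<bar>\<beta>\<bar>) * real (?L M) = 0)"
      proof
        assume "\<forall>M. real (N M) = 0 \<and> (2 + 128 * \<bar>\<beta>\<bar>) * real (?L M) = 0"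
        then have "real (?L M) = 0" for M using \<beta> by (auto simp: add_eq_0_iff)
        then show False using large[of 1] by (simp add: eventually_sequentially)
      qed
      then obtain n0 where n0: "real (N M) / ((2 + 128 * \<bar>\<beta>\<bar>) * real (?L M)) > 1" if "M > n0" for M
        using N unfolding eventually_dominates_def by blast
      show ?thesis
        using large[of 1] eventually_gt_at_top[of n0]
      proof eventually_elim
        case (elim M)
        then have "0 < (2 + 128 * \<beta>) * real (?L M)" using \<beta> by simp
        then show ?case using n0[OF elim(2)] \<beta> by (simp add: less_divide_eq_1_pos)
      qed
    qed
    \<comment> \<open>The level \<open>2 * \<nu> ^ 4\<close> yields the estimate \<open>La\<close>
      below where \<open>a M\<close> is the signal-to-noise ratio; where \<open>a M\<close> is
      capped at 1, it follows from \<open>2 * ln y \<le> y\<close>.\<close>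
    have "\<forall>\<^sub>F M in sequentially. 2 * \<nu> ^ 4 \<le> real (?L M) * min_mag M (x M) ^ 4 / ln (real (?L M))"
      using snr by (simp add: filterlim_at_top)
    moreover have "\<forall>\<^sub>F y in at_top. 2 * ln y \<le> (y::real)" by real_asymp
    then have "\<forall>\<^sub>F M in sequentially. 2 * ln (real (?L M)) \<le> real (?L M)"
      using Linf by (rule eventually_compose_filterlim)
    ultimately have La: "\<forall>\<^sub>F M in sequentially. 2 * ln (real (?L M)) \<le> real (?L M) * (a M)\<^sup>2"
      using large[of 2]
    proof eventually_elim
      case (elim M)
      have "ln (real (?L M)) > 0" using elim by simp
      then have "2 * \<nu> ^ 4 * ln (real (?L M)) \<le> real (?L M) * min_mag M (x M) ^ 4"
        using elim(1) by (simp add: le_divide_eq)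
      then have "2 * ln (real (?L M)) \<le> real (?L M) * ((min_mag M (x M))\<^sup>2 / \<nu>\<^sup>2)\<^sup>2"
        using \<nu> by (simp add: power_divide le_divide_eq mult_ac)
      then show ?case using elim(2) by (simp add: a_def min_def)
    qed
    \<comment> \<open>For positive \<open>y\<close> this is \<open>1 / y\<^sup>2\<close>, kept as an
      exponential so that comparisons are linear in \<open>ln y\<close>.\<close>
    let ?e = "\<lambda>y::real. exp (- 2 * ln y)"
    have bound: "\<forall>\<^sub>F M in sequentially. p_err \<nu> (N M) M (D M) (x M)
        \<le> 2 ^ M * exp (- real M) + (?e (real (?L M)) + exp (?e (real (?L M))) - 1)"
      using Nlarge La large[of "2 * \<beta>"]
    proof eventually_elim
      case (elim M)
      define L where "L = ?L M"
      define m where "m = N M - L"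
      define R where "R = real L"
      have R: "R \<ge> 2 * \<beta>" "R \<ge> 4" using elim(3) \<beta> by (auto simp: R_def L_def)
      have LM: "L \<le> M" unfolding L_def by (rule sparsity_le[OF \<beta>])
      have "R \<le> (2 + 128 * \<beta>) * R" using R \<beta> by (simp add: mult_le_cancel_right1)
      then have NL: "N M = L + m" using elim(1) by (simp add: m_def R_def L_def)
      have "(2 + 128 * \<beta>) * R < R + m" using elim(1) NL by (simp add: R_def L_def)
      then have m: "128 * \<beta> * R \<le> m" using R by (simp add: algebra_simps)
      have "(1 / \<beta>) * real M \<le> R + 1" unfolding R_def L_def sparsity_def by linarith
      then have "real M \<le> \<beta> * (R + 1)" using \<beta> by (simp add: divide_le_eq mult.commute)
      also have "\<dots> \<le> \<beta> * (2 * R)" using R \<beta> by (intro mult_left_mono) auto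
      finally have MR: "real M \<le> 2 * \<beta> * R" by simp
      have a01: "0 \<le> a M" "a M \<le> 1" by (auto simp: a_def)
      have ax: "a M * \<nu>\<^sup>2 \<le> (cmod (x M i))\<^sup>2" if "i \<in> vsupp M (x M)" for i
      proof -
        have fin: "finite ((\<lambda>i. cmod (x M i)) ` vsupp M (x M))" by (simp add: vsupp_def)
        have "min_mag M (x M) \<le> cmod (x M i)"
          unfolding min_mag_def using fin that by (intro Min_le) auto
        moreover have "0 \<le> min_mag M (x M)"
          unfolding min_mag_def using fin that by (intro Min.boundedI) auto
        ultimately have "(min_mag M (x M))\<^sup>2 \<le> (cmod (x M i))\<^sup>2" by (rule power_mono)
        moreover have "a M * \<nu>\<^sup>2 \<le> (min_mag M (x M))\<^sup>2 / \<nu>\<^sup>2 * \<nu>\<^sup>2"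
          by (intro mult_right_mono) (auto simp: a_def)
        ultimately show ?thesis using \<nu> by simp
      qed
      have lnR: "0 \<le> ln R" using R by simp
      have "128 * \<beta> * R * (a M)\<^sup>2 \<le> m * (a M)\<^sup>2" using m by (intro mult_right_mono) auto
      moreover have "2 * ln R \<le> R * (a M)\<^sup>2" using elim(2) by (simp add: R_def L_def)
      then have "2 * (2 * ln R) \<le> \<beta> * (R * (a M)\<^sup>2)"
        using \<beta> lnR by (intro mult_mono[of 2 \<beta>]) auto
      \<comment> \<open>The constant is 128 * 2 * 2, from the bound on \<open>m\<close>, from
        \<beta> > 2 and from \<open>La\<close>. It makes \<open>r\<close> at most
        \<open>exp (- 4 * ln R)\<close>, while \<open>M \<le> R * R\<close>, whence
        \<open>M * r \<le> exp (- 2 * ln R)\<close>.\<close>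
      ultimately have ma: "512 * ln R \<le> m * (a M)\<^sup>2" by (simp add: mult_ac)
      define r where "r = exp (- (m * (a M)\<^sup>2 / 128))"
      have "ln (real M) \<le> 2 * ln R" if "M > 0"
      proof -
        have "real M \<le> R * R" using MR R \<beta> mult_right_mono[of "2 * \<beta>" R R] by linarith
        then have "ln (real M) \<le> ln (R * R)" using that by (intro ln_mono) auto
        also have "\<dots> = 2 * ln R" using R by (simp add: ln_mult)
        finally show ?thesis .
      qed
      moreover have M0: "M > 0" using LM R by (auto simp: R_def)
      ultimately have "ln (real M) + - (m * (a M)\<^sup>2 / 128) \<le> - 2 * ln R" using ma lnR by simp
      then have "exp (ln (real M) + - (m * (a M)\<^sup>2 / 128)) \<le> ?e R" by (simp only: exp_le_cancel_iff)
      moreover have "exp (ln (real M)) = real M" using M0 by simp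
      ultimately have Mr: "M * r \<le> ?e R" by (simp only: exp_add r_def)
      have "(1 + r) ^ M \<le> exp r ^ M" by (intro power_mono exp_ge_add_one_self) (auto simp: r_def)
      also have "\<dots> = exp (M * r)" by (simp add: exp_of_nat_mult)
      also have "\<dots> \<le> exp (?e R)" using Mr by simp
      finally have 1: "(1 + r) ^ M \<le> exp (?e R)" .
      have 2: "exp (- (m * (a M)\<^sup>2 / 32)) \<le> ?e R" using ma lnR by simp
      \<comment> \<open>Here \<open>m \<ge> 64 * M\<close> enters; the right side is the M-th power
        of 2/e, which tends to zero.\<close>
      have 3: "2 ^ M * exp (- (m / 64)) \<le> 2 ^ M * exp (- real M)"
        using m MR by (intro mult_left_mono) auto
      have "p_err \<nu> (N M) M (D M) (x M)
         \<le> exp (- (m * (a M)\<^sup>2 / 32)) + 2 ^ M * exp (- (m / 64)) + ((1 + r) ^ M - 1)"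
        unfolding D_def r_def L_def[symmetric] using \<nu> LM l0 NL a01 ax
        by (intro p_err_min_residual_explicit) (auto simp: L_def)
      then show ?case using 1 2 3 unfolding L_def[symmetric] R_def[symmetric] by linarith
    qed
    have "((\<lambda>y. ?e y + exp (?e y) - 1) \<longlongrightarrow> 0) at_top" by real_asymp
    from filterlim_compose[OF this Linf]
    have "(\<lambda>M. ?e (real (?L M)) + exp (?e (real (?L M))) - 1) \<longlonglongrightarrow> 0" .
    moreover have "(\<lambda>M. 2 ^ M * exp (- real M) :: real) \<longlonglongrightarrow> 0"
    proof -
      have "2 < exp (1 :: real)" using exp_lower_Taylor_quadratic[of 1] by simp
      then have "(\<lambda>M. (2 * exp (- 1)) ^ M :: real) \<longlonglongrightarrow> 0"
        by (intro LIMSEQ_realpow_zero) (auto simp: exp_minus field_simps)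
      moreover have "(2 * exp (- 1)) ^ M = 2 ^ M * exp (- real M)" for M
        using exp_of_nat_mult[of M "- 1 :: real"] by (simp add: power_mult_distrib)
      ultimately show ?thesis by simp
    qed
    ultimately have "(\<lambda>M. 2 ^ M * exp (- real M) + (?e (real (?L M)) + exp (?e (real (?L M))) - 1)) \<longlonglongrightarrow> 0 + 0"
      by (intro tendsto_add)
    then show "reliable_recovery \<nu> N D x"
      unfolding reliable_recovery_def using bound
      by (intro tendsto_sandwich[OF _ bound tendsto_const])
        (auto simp: p_err_def p_err_fixed_def intro!: always_eventually integral_nonneg)
  qed
qed

end
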